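(* Let $\Delta=(\delta_i:i\in I)$ be a type such that $|I|\le 2$. Then the MAC problem for $\Delta$-structures is (algorithmically) decidable.
   Context: A type is a finite family $\Delta=(\delta_i:i\in I)$ of integers $\delta_i\ge 2$. A $\Delta$-structure $A$ consists of a finite non-empty base set $\underline{A}$ and relations $R_i(A)\subseteq\underline{A}^{\delta_i}$ ($i\in I$). A homomorphism $A\to B$ is a map of base sets mapping $R_i(A)$ into $R_i(B)$ for every $i$; write $A\to B$ if one exists. Homomorphically equivalent structures ($A\to B$ and $B\to A$) are identified in the homomorphism order $\mathcal C(\Delta)$, the partial order induced by $\to$. The MAC problem is to decide whether an input finite non-empty set $\mathcal Q$ of $\Delta$-structures is a maximal antichain in $\mathcal C(\Delta)$, i.e. whether distinct elements of $\mathcal Q$ are pairwise incomparable under $\to$ and every $\Delta$-structure $A$ satisfies $A\to Q$ or $Q\to A$ for some $Q\in\mathcal Q$. *)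

theory Defs
  imports "HOL-Library.Nat_Bijection" "HOL-Library.Countable_Set"
begin

section \<open>Relational structures\<close>

text \<open>
  A type is a family \<open>\<delta> i\<close> (\<open>i \<in> I\<close>). Tuples are lists. Relations at indices outside \<open>I\<close> are
  required to be empty, so that equality of structures depends only on the base set and on the
  relations indexed by \<open>I\<close>.
\<close>

definition is_type :: "'i set \<Rightarrow> ('i \<Rightarrow> nat) \<Rightarrow> bool" where
  "is_type I \<delta> \<longleftrightarrow> finite I \<and> (\<forall>i\<in>I. 2 \<le> \<delta> i)"

record ('i, 'a) rel_structure =
  base :: "'a set"
  rel :: "'i \<Rightarrow> 'a list set"

definition is_structure :: "'i set \<Rightarrow> ('i \<Rightarrow> nat) \<Rightarrow> ('i, 'a) rel_structure \<Rightarrow> bool" where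
  "is_structure I \<delta> A \<longleftrightarrow>
     finite (base A) \<and> base A \<noteq> {} \<and>
     (\<forall>i\<in>I. rel A i \<subseteq> {t. length t = \<delta> i \<and> set t \<subseteq> base A}) \<and>
     (\<forall>i. i \<notin> I \<longrightarrow> rel A i = {})"

definition is_hom ::
    "'i set \<Rightarrow> ('i, 'a) rel_structure \<Rightarrow> ('i, 'b) rel_structure \<Rightarrow> ('a \<Rightarrow> 'b) \<Rightarrow> bool" where
  "is_hom I A B h \<longleftrightarrow> h ` base A \<subseteq> base B \<and> (\<forall>i\<in>I. map h ` rel A i \<subseteq> rel B i)"

definition hom_to :: "'i set \<Rightarrow> ('i, 'a) rel_structure \<Rightarrow> ('i, 'b) rel_structure \<Rightarrow> bool" where
  "hom_to I A B \<longleftrightarrow> (\<exists>h. is_hom I A B h)"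

text \<open>
  From here on the base sets are finite sets of natural numbers; every finite structure is
  isomorphic to one of these.
\<close>

lemma structure_iso_nat:
  fixes A :: "('i, 'a) rel_structure"
  assumes "is_structure I \<delta> A"
  obtains B :: "('i, nat) rel_structure" and h k where
    "is_structure I \<delta> B" "is_hom I A B h" "is_hom I B A k"
    "\<And>x. x \<in> base A \<Longrightarrow> k (h x) = x" "\<And>y. y \<in> base B \<Longrightarrow> h (k y) = y"
proof -
  have fin: "finite (base A)" using assms by (simp add: is_structure_def)
  define h where "h = to_nat_on (base A)"
  define k where "k = inv_into (base A) h"
  define B where "B = \<lparr>base = h ` base A, rel = (\<lambda>i. map h ` rel A i)\<rparr>"
  have inj: "inj_on h (base A)"
    unfolding h_def using fin by (simp add: countable_finite inj_on_to_nat_on)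
  have kh: "k (h x) = x" if "x \<in> base A" for x
    unfolding k_def using inj that by simp
  have tup: "set t \<subseteq> base A" if "i \<in> I" "t \<in> rel A i" for i t
    using assms that by (auto simp: is_structure_def)
  have map_kh: "map (k \<circ> h) t = t" if "i \<in> I" "t \<in> rel A i" for i t
    using tup[OF that] by (intro map_idI) (auto simp: kh)
  show thesis
  proof (rule that)
    show "is_structure I \<delta> B"
      unfolding is_structure_def
    proof (intro conjI ballI allI impI subsetI)
      fix i s assume i: "i \<in> I" and "s \<in> rel B i"
      then obtain t where t: "t \<in> rel A i" "s = map h t" by (auto simp: B_def)
      have "length t = \<delta> i" using assms i t(1) by (auto simp: is_structure_def)
      then show "s \<in> {t. length t = \<delta> i \<and> set t \<subseteq> base B}"
        using tup[OF i t(1)] t(2) by (auto simp: B_def)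
    qed (use assms in \<open>simp_all add: is_structure_def B_def\<close>)
    show "is_hom I A B h" by (simp add: is_hom_def B_def)
    show "is_hom I B A k" by (auto simp: is_hom_def B_def kh map_kh)
    show "k (h x) = x" if "x \<in> base A" for x using kh[OF that] .
    show "h (k y) = y" if "y \<in> base B" for y using that by (auto simp: B_def kh)
  qed
qed

definition maximal_antichain ::
    "'i set \<Rightarrow> ('i \<Rightarrow> nat) \<Rightarrow> ('i, nat) rel_structure set \<Rightarrow> bool" where
  "maximal_antichain I \<delta> Q \<longleftrightarrow>
     (\<forall>A\<in>Q. \<forall>B\<in>Q. A \<noteq> B \<longrightarrow> \<not> hom_to I A B \<and> \<not> hom_to I B A) \<and>
     (\<forall>A :: ('i, nat) rel_structure. is_structure I \<delta> A \<longrightarrow>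
        (\<exists>B\<in>Q. hom_to I A B \<or> hom_to I B A))"

definition is_MAC_input ::
    "'i set \<Rightarrow> ('i \<Rightarrow> nat) \<Rightarrow> ('i, nat) rel_structure set \<Rightarrow> bool" where
  "is_MAC_input I \<delta> Q \<longleftrightarrow> finite Q \<and> Q \<noteq> {} \<and> (\<forall>A\<in>Q. is_structure I \<delta> A)"


section \<open>Decidability\<close>

text \<open>
  Kleene's partial recursive functions. \<open>rec_eval f xs y\<close> means that \<open>f\<close> halts on the arguments
  \<open>xs\<close> with value \<open>y\<close>. Arities are not part of the syntax: \<open>Zero\<close> and \<open>Proj i\<close> stand for the
  constant and projection functions of all arities for which they make sense.
\<close>

datatype recf =
    Zero
  | Succ
  | Proj nat
  | Comp recf "recf list"
  | Prec recf recf
  | Mu recf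

inductive rec_eval :: "recf \<Rightarrow> nat list \<Rightarrow> nat \<Rightarrow> bool" where
  Zero: "rec_eval Zero xs 0"
| Succ: "rec_eval Succ [x] (Suc x)"
| Proj: "i < length xs \<Longrightarrow> rec_eval (Proj i) xs (xs ! i)"
| Comp: "list_all2 (\<lambda>g y. rec_eval g xs y) gs ys \<Longrightarrow> rec_eval f ys z \<Longrightarrow>
    rec_eval (Comp f gs) xs z"
| Prec_0: "rec_eval f xs y \<Longrightarrow> rec_eval (Prec f g) (0 # xs) y"
| Prec_Suc: "rec_eval (Prec f g) (n # xs) y \<Longrightarrow> rec_eval g (n # y # xs) z \<Longrightarrow>
    rec_eval (Prec f g) (Suc n # xs) z"
| Mu: "rec_eval f (m # xs) 0 \<Longrightarrow> (\<forall>k<m. \<exists>y. rec_eval f (k # xs) (Suc y)) \<Longrightarrow>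
    rec_eval (Mu f) xs m"

lemma rec_eval_deterministic:
  "rec_eval f xs y \<Longrightarrow> rec_eval f xs z \<Longrightarrow> y = z"
proof (induction arbitrary: z rule: rec_eval.induct)
  case (Comp xs gs ys f w)
  from Comp.prems obtain ys' where
    ys': "list_all2 (\<lambda>g y. rec_eval g xs y) gs ys'" and f: "rec_eval f ys' z"
    by (cases rule: rec_eval.cases) auto
  have "ys = ys'"
    using Comp.IH(1) ys' by (auto simp: list_all2_conv_all_nth intro!: nth_equalityI)
  with f Comp.IH(2) show ?case by simp
next
  case (Prec_Suc f g n xs y w)
  from Prec_Suc.prems obtain y' where
    "rec_eval (Prec f g) (n # xs) y'" "rec_eval g (n # y' # xs) z"
    by (cases rule: rec_eval.cases) auto
  then show ?case using Prec_Suc.IH by metis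
next
  case (Mu f m xs)
  from Mu.prems have z: "rec_eval f (z # xs) 0" "\<forall>k<z. \<exists>y. rec_eval f (k # xs) (Suc y)"
    by (cases rule: rec_eval.cases; auto)+
  show ?case
  proof (rule linorder_cases[of m z])
    assume "m < z"
    then show ?thesis using z(2) Mu.IH(1) by fastforce
  next
    assume "z < m"
    then show ?thesis using z(1) Mu.IH(2) by fastforce
  qed
qed (erule rec_eval.cases; simp)+

definition decidable :: "nat set \<Rightarrow> bool" where
  "decidable L \<longleftrightarrow> (\<exists>f. \<forall>n. rec_eval f [n] (if n \<in> L then 1 else 0))"


section \<open>The MAC problem\<close>

text \<open>
  Inputs are coded by natural numbers by means of the bijections \<^const>\<open>prod_encode\<close>,
  \<^const>\<open>list_encode\<close> and (on finite sets) \<^const>\<open>set_encode\<close>. The indices in the finite set \<open>I\<close>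
  are numbered by \<^term>\<open>to_nat_on I\<close>, a bijection onto \<open>{..<card I}\<close>.
\<close>

definition encode_structure :: "'i set \<Rightarrow> ('i, nat) rel_structure \<Rightarrow> nat" where
  "encode_structure I A =
     prod_encode (set_encode (base A),
       set_encode {prod_encode (to_nat_on I i, list_encode t) | i t. i \<in> I \<and> t \<in> rel A i})"

definition encode_input :: "'i set \<Rightarrow> ('i, nat) rel_structure set \<Rightarrow> nat" where
  "encode_input I Q = set_encode (encode_structure I ` Q)"

lemma inj_on_encode_structure:
  assumes "finite I"
  shows "inj_on (encode_structure I) {A. is_structure I \<delta> A}"
proof (rule inj_onI)
  fix A B :: "('a, nat) rel_structure"
  assume A: "A \<in> {A. is_structure I \<delta> A}" and B: "B \<in> {A. is_structure I \<delta> A}"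
    and eq: "encode_structure I A = encode_structure I B"
  let ?c = "\<lambda>(i, t). prod_encode (to_nat_on I i, list_encode t)"
  let ?S = "\<lambda>A :: ('a, nat) rel_structure. Sigma I (rel A)"
  have code: "{prod_encode (to_nat_on I i, list_encode t) | i t. i \<in> I \<and> t \<in> rel C i} = ?c ` ?S C"
    for C :: "('a, nat) rel_structure" by force
  have fin: "finite (?S C)" if "is_structure I \<delta> C" for C :: "('a, nat) rel_structure"
  proof (rule finite_SigmaI[OF assms])
    fix i assume "i \<in> I"
    then have "rel C i \<subseteq> {t. set t \<subseteq> base C \<and> length t = \<delta> i}" and "finite (base C)"
      using that by (auto simp: is_structure_def)
    then show "finite (rel C i)" by (simp add: finite_lists_length_eq finite_subset)
  qed
  have "inj_on ?c (I \<times> UNIV)"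
    using inj_on_to_nat_on[OF countable_finite[OF assms]] by (auto simp: inj_on_def dest: injD[OF inj_list_encode])
  moreover have "?c ` ?S A = ?c ` ?S B" and base: "base A = base B"
    using eq A B fin
    by (auto simp: encode_structure_def code set_encode_eq is_structure_def)
  ultimately have "?S A = ?S B"
    using inj_on_image_eq_iff[of ?c "I \<times> UNIV" "?S A" "?S B"] by blast
  then have "rel A i = rel B i" if "i \<in> I" for i using that by auto
  moreover have "rel A i = rel B i" if "i \<notin> I" for i
    using that A B by (simp add: is_structure_def)
  ultimately have "rel A = rel B" by (intro ext) blast
  with base show "A = B" by simp
qed

lemma inj_on_encode_input:
  assumes "finite I"
  shows "inj_on (encode_input I) {Q. is_MAC_input I \<delta> Q}"
proof (rule inj_onI)
  fix Q R :: "('a, nat) rel_structure set"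
  assume "Q \<in> {Q. is_MAC_input I \<delta> Q}" "R \<in> {Q. is_MAC_input I \<delta> Q}"
    and "encode_input I Q = encode_input I R"
  then show "Q = R"
    using inj_on_image_eq_iff[OF inj_on_encode_structure[OF assms, of \<delta>], of Q R]
    by (auto simp: encode_input_def is_MAC_input_def set_encode_eq)
qed

definition MAC :: "'i set \<Rightarrow> ('i \<Rightarrow> nat) \<Rightarrow> nat set" where
  "MAC I \<delta> = {encode_input I Q | Q. is_MAC_input I \<delta> Q \<and> maximal_antichain I \<delta> Q}"

end

theory Submission
  imports Defs "HOL-Library.Ramsey" "HOL-Library.Infinite_Set"
begin

text \<open>
  Membership in the MAC problem reduces to a search that is bounded by a recursive function of the
  input. Let \<open>Q\<close> be a finite set of structures with at most \<open>n\<close> elements each.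

  The first reduction is to forests, the structures without cycles. Every structure is comparable to
  a member of \<open>Q\<close> if and only if every structure \<open>A\<close> maps to a member of \<open>Q\<close> or lies above a forest with
  at most \<open>n\<close> elements that in turn lies above a member of \<open>Q\<close> (\<open>maximal_iff_forests\<close>). The nontrivial
  direction is a form of the sparse incomparability lemma: \<open>A\<close> has a cover \<open>A'\<close> that maps to the same
  structures of size at most \<open>n\<close> as \<open>A\<close>, but such that homomorphisms from structures of size at most
  \<open>n\<close> to \<open>A'\<close> factor, after projection to \<open>A\<close>, through forests (\<open>sparse_incomparability\<close>). The cover is
  explicit: a shift construction on finite sets of numbers, as in shift graphs, cuts small
  substructures along chosen tuples (\<open>shift_levels\<close>), while Ramsey's theorem guarantees that small
  targets are preserved (\<open>hom_from_shift\<close>). Iterating it over all tuples turns the small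
  substructures on which the projection is injective into forests, and iterating the result \<open>n\<close> times
  leaves no others.

  The second reduction bounds \<open>A\<close>. Identify elements of \<open>A\<close> to which the same pointed structures on
  subsets of \<open>{..<n}\<close> map. A forest on such a subset that maps to the quotient also maps to \<open>A\<close>, since a
  homomorphism can be lifted tuple by tuple (\<open>forest_lift\<close>). The size of the quotient is bounded in
  terms of \<open>n\<close>, and \<open>A\<close> maps to it, so it is a counterexample whenever \<open>A\<close> is (\<open>maximal_iff_bounded\<close>).

  What remains is arithmetic with bounded quantifiers over codes of structures and maps
  (\<open>maximal_antichain_coded_iff\<close>), and relations of this form are decided by Kleene's functions.
\<close>


section \<open>Images of structures and forests\<close>

definition image_structure ::
    "('a \<Rightarrow> 'b) \<Rightarrow> ('i, 'a) rel_structure \<Rightarrow> ('i, 'b) rel_structure" where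
  "image_structure h A = \<lparr>base = h ` base A, rel = (\<lambda>i. map h ` rel A i)\<rparr>"

lemma base_image_structure [simp]: "base (image_structure h A) = h ` base A"
  and rel_image_structure [simp]: "rel (image_structure h A) i = map h ` rel A i"
  by (simp_all add: image_structure_def)

lemma structure_tuple:
  assumes "is_structure I \<delta> A" "i \<in> I" "t \<in> rel A i"
  shows "length t = \<delta> i" "set t \<subseteq> base A"
  using assms by (auto simp: is_structure_def)

lemma finite_tuples:
  assumes "finite I" "is_structure I \<delta> A"
  shows "finite (Sigma I (rel A))"
proof (rule finite_SigmaI[OF assms(1)])
  fix i assume "i \<in> I"
  then have "rel A i \<subseteq> {t. set t \<subseteq> base A \<and> length t = \<delta> i}"
    using structure_tuple[OF assms(2)] by blast
  moreover have "finite {t. set t \<subseteq> base A \<and> length t = \<delta> i}"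
    using assms(2) by (intro finite_lists_length_eq) (simp add: is_structure_def)
  ultimately show "finite (rel A i)" by (rule finite_subset)
qed

lemma is_structure_image:
  assumes "is_structure I \<delta> A"
  shows "is_structure I \<delta> (image_structure h A)"
  unfolding is_structure_def
proof (intro conjI ballI allI impI subsetI)
  fix i s assume i: "i \<in> I" and "s \<in> rel (image_structure h A) i"
  then obtain t where t: "t \<in> rel A i" "s = map h t" by auto
  have "length t = \<delta> i" "set t \<subseteq> base A" using structure_tuple[OF assms i t(1)] .
  then show "s \<in> {t. length t = \<delta> i \<and> set t \<subseteq> base (image_structure h A)}"
    using t(2) by auto
qed (use assms in \<open>simp_all add: is_structure_def\<close>)

lemma is_hom_image: "is_hom I A (image_structure h A) h"
  by (simp add: is_hom_def)

lemma is_hom_id [simp]: "is_hom I A A (\<lambda>x. x)"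
  by (simp add: is_hom_def)

lemma is_hom_tuple:
  assumes "is_hom I A B h" "i \<in> I" "t \<in> rel A i"
  shows "map h t \<in> rel B i"
  using assms unfolding is_hom_def by blast

lemma is_hom_comp:
  assumes "is_hom I A B g" "is_hom I B C h"
  shows "is_hom I A C (\<lambda>x. h (g x))"
proof -
  have "map (\<lambda>x. h (g x)) t \<in> rel C i" if "i \<in> I" "t \<in> rel A i" for i t
  proof -
    have "map h (map g t) \<in> rel C i"
      using is_hom_tuple[OF assms(2) that(1)] is_hom_tuple[OF assms(1) that] by blast
    then show ?thesis by (simp add: comp_def)
  qed
  moreover have "(\<lambda>x. h (g x)) ` base A \<subseteq> base C"
    using assms by (fastforce simp: is_hom_def)
  ultimately show ?thesis unfolding is_hom_def by blast
qed

lemma hom_to_refl: "hom_to I A A"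
  unfolding hom_to_def using is_hom_id by blast

lemma hom_to_trans: "hom_to I A B \<Longrightarrow> hom_to I B C \<Longrightarrow> hom_to I A C"
  unfolding hom_to_def by (blast intro: is_hom_comp)

lemma is_hom_from_image:
  assumes "is_structure I \<delta> A" "is_hom I A B f" "\<And>x. x \<in> base A \<Longrightarrow> g (h x) = f x"
  shows "is_hom I (image_structure h A) B g"
proof -
  have maps: "map (g \<circ> h) t = map f t" if "i \<in> I" "t \<in> rel A i" for i t
    using structure_tuple[OF assms(1) that] assms(3) by auto
  have "map g ` rel (image_structure h A) i \<subseteq> rel B i" if "i \<in> I" for i
  proof (rule subsetI)
    fix s assume "s \<in> map g ` rel (image_structure h A) i"
    then obtain t where t: "t \<in> rel A i" "s = map (g \<circ> h) t" by auto
    have "map f t \<in> rel B i" using is_hom_tuple[OF assms(2) that t(1)] .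
    then show "s \<in> rel B i" using maps[OF that t(1)] t(2) by (simp only:)
  qed
  moreover have "g ` base (image_structure h A) \<subseteq> base B"
    using assms by (auto simp: is_hom_def)
  ultimately show ?thesis by (simp only: is_hom_def) blast
qed

text \<open>
  Every tuple is a bridge of the bipartite graph that joins the tuples to their entries: the colouring
  names the components that remain when the tuple is removed. So this graph has no cycle. Bridges
  are easier to handle than cycles here: the cover below yields the colourings directly, and lifting
  and decision procedures use them.
\<close>

definition is_forest :: "'i set \<Rightarrow> ('i, 'a) rel_structure \<Rightarrow> bool" where
  "is_forest I A \<longleftrightarrow> (\<forall>i\<in>I. \<forall>t\<in>rel A i. \<exists>c :: 'a \<Rightarrow> nat. distinct (map c t) \<and>
     (\<forall>j\<in>I. \<forall>s\<in>rel A j. (j, s) \<noteq> (i, t) \<longrightarrow> (\<forall>x\<in>set s. \<forall>y\<in>set s. c x = c y)))"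

lemma is_forest_image:
  fixes A :: "('i, 'a) rel_structure" and h :: "'a \<Rightarrow> 'b"
  assumes A: "is_structure I \<delta> A" and F: "is_forest I A" and inj: "inj_on h (base A)"
  shows "is_forest I (image_structure h A)"
  unfolding is_forest_def
proof (intro ballI)
  fix i t' assume i: "i \<in> I" and "t' \<in> rel (image_structure h A) i"
  then obtain t where t: "t \<in> rel A i" "t' = map h t" by auto
  obtain c :: "'a \<Rightarrow> nat" where c: "distinct (map c t)"
    "\<forall>j\<in>I. \<forall>s\<in>rel A j. (j, s) \<noteq> (i, t) \<longrightarrow> (\<forall>x\<in>set s. \<forall>y\<in>set s. c x = c y)"
    using bspec[OF bspec[OF F[unfolded is_forest_def] i] t(1)] by (elim exE conjE) (rule that)
  define k where "k = inv_into (base A) h"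
  have k: "k (h x) = x" if "x \<in> base A" for x
    unfolding k_def using inj that by simp
  have "map (\<lambda>y. c (k y)) t' = map c t"
    unfolding t(2) using structure_tuple(2)[OF A i t(1)] k by (simp add: subset_iff)
  with c(1) have 1: "distinct (map (\<lambda>y. c (k y)) t')" by simp
  have 2: "c (k x) = c (k y)"
    if "j \<in> I" "s' \<in> rel (image_structure h A) j" "(j, s') \<noteq> (i, t')" "x \<in> set s'" "y \<in> set s'"
    for j s' x y
  proof -
    from that(2) obtain s where s: "s \<in> rel A j" "s' = map h s" by auto
    have sub: "set s \<subseteq> base A" using structure_tuple(2)[OF A that(1) s(1)] .
    from that(4,5) obtain u v where uv: "u \<in> set s" "x = h u" "v \<in> set s" "y = h v"
      by (auto simp: s(2))
    then have "k x = u" "k y = v" using sub k by (simp_all add: subset_iff)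
    moreover from that(3) s(2) t(2) have "(j, s) \<noteq> (i, t)" by auto
    ultimately show ?thesis using c(2)[rule_format, OF that(1) s(1), of u v] uv by simp
  qed
  show "\<exists>c :: 'b \<Rightarrow> nat. distinct (map c t') \<and>
     (\<forall>j\<in>I. \<forall>s\<in>rel (image_structure h A) j. (j, s) \<noteq> (i, t') \<longrightarrow>
        (\<forall>x\<in>set s. \<forall>y\<in>set s. c x = c y))"
    by (rule exI[of _ "\<lambda>y. c (k y)"]) (rule conjI[OF 1], use 2 in blast)
qed

lemma relabel:
  fixes A :: "('i, 'a) rel_structure"
  assumes A: "is_structure I \<delta> A" and n: "card (base A) \<le> n"
  obtains B :: "('i, nat) rel_structure" where "is_structure I \<delta> B" "base B \<subseteq> {..<n}"
    "hom_to I A B" "hom_to I B A" "is_forest I A \<Longrightarrow> is_forest I B"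
proof -
  from A have fin: "finite (base A)" by (simp add: is_structure_def)
  then obtain h where h: "bij_betw h (base A) {0..<card (base A)}"
    using ex_bij_betw_finite_nat by blast
  then have inj: "inj_on h (base A)" by (simp add: bij_betw_def)
  show thesis
  proof
    show "is_structure I \<delta> (image_structure h A)" using A by (rule is_structure_image)
    show "is_forest I (image_structure h A)" if "is_forest I A"
      using A that inj by (rule is_forest_image)
    show "base (image_structure h A) \<subseteq> {..<n}" using bij_betw_imp_surj_on[OF h] n by auto
    show "hom_to I A (image_structure h A)" using is_hom_image by (auto simp: hom_to_def)
    have "is_hom I (image_structure h A) A (inv_into (base A) h)"
      by (rule is_hom_from_image[OF A is_hom_id]) (simp add: inj)
    then show "hom_to I (image_structure h A) A" by (auto simp: hom_to_def)
  qed
qed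


section \<open>Counting elements of shifted windows\<close>

lemma down_closed_nat:
  fixes D :: "nat set"
  assumes "finite D" and down: "\<And>p q. p \<in> D \<Longrightarrow> q < p \<Longrightarrow> q \<in> D"
  shows "D = {..<card D}"
proof -
  define q where "q = (LEAST x. x \<notin> D)"
  from assms(1) have "\<exists>x. x \<notin> D" using ex_new_if_finite[OF infinite_UNIV_nat] by blast
  then have q: "q \<notin> D" unfolding q_def by (rule LeastI_ex)
  have "D = {..<q}"
  proof (rule set_eqI)
    fix p
    show "p \<in> D \<longleftrightarrow> p \<in> {..<q}"
      using not_less_Least[of p "\<lambda>x. x \<notin> D"] down[of p q] q unfolding q_def[symmetric]
      by (cases p q rule: linorder_cases) auto
  qed
  then show ?thesis by (metis card_lessThan)
qed

text \<open>
  The elements below \<open>\<theta>\<close> occupy an initial segment of the positions. So, as long as nothing is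
  truncated, shifting the window by one position lowers the count by one, whatever \<open>\<theta>\<close> is.
\<close>

lemma card_window_below:
  fixes \<tau> :: "nat \<Rightarrow> nat"
  assumes mono: "strict_mono_on {..<m} \<tau>" and le: "j + k \<le> m"
  shows "card {s \<in> \<tau> ` {j..<j + k}. s < \<theta>} = min k (card {p. p < m \<and> \<tau> p < \<theta>} - j)"
proof -
  define q where "q = card {p. p < m \<and> \<tau> p < \<theta>}"
  have q: "{p. p < m \<and> \<tau> p < \<theta>} = {..<q}"
    unfolding q_def
  proof (rule down_closed_nat)
    fix p p' assume "p \<in> {p. p < m \<and> \<tau> p < \<theta>}" "p' < p"
    moreover from this have "\<tau> p' < \<tau> p" by (intro strict_mono_onD[OF mono]) auto
    ultimately show "p' \<in> {p. p < m \<and> \<tau> p < \<theta>}" by simp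
  qed simp
  have "{s \<in> \<tau> ` {j..<j + k}. s < \<theta>} = \<tau> ` ({j..<j + k} \<inter> {p. p < m \<and> \<tau> p < \<theta>})"
    using le by auto
  also have "{j..<j + k} \<inter> {p. p < m \<and> \<tau> p < \<theta>} = {j..<min (j + k) q}"
    unfolding q by auto
  finally have "card {s \<in> \<tau> ` {j..<j + k}. s < \<theta>} = card (\<tau> ` {j..<min (j + k) q})" by simp
  also have "\<dots> = card {j..<min (j + k) q}"
  proof (rule card_image)
    have "inj_on \<tau> {..<m}" using mono by (rule strict_mono_on_imp_inj_on)
    then show "inj_on \<tau> {j..<min (j + k) q}" by (rule inj_on_subset) (use le in auto)
  qed
  also have "\<dots> = min k (q - j)" by (auto simp: min_def)
  finally show ?thesis unfolding q_def .
qed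

lemma threshold_exists:
  fixes S :: "nat set"
  assumes "finite S" and "K < card S"
  shows "\<exists>\<theta>. card {s \<in> S. s < \<theta>} = K"
proof -
  obtain \<tau> where \<tau>: "bij_betw \<tau> {..<card S} S" "strict_mono_on {..<card S} \<tau>"
    using ex_bij_betw_strict_mono_card[OF assms(1)] .
  have less: "\<tau> p < \<tau> K \<longleftrightarrow> p < K" if "p < card S" for p
    using strict_mono_on_less[OF \<tau>(2)] that assms(2) by simp
  have "{s \<in> \<tau> ` {..<card S}. s < \<tau> K} = \<tau> ` {..<K}"
    using assms(2) less by auto
  then have "{s \<in> S. s < \<tau> K} = \<tau> ` {..<K}"
    by (simp only: bij_betw_imp_surj_on[OF \<tau>(1)])
  moreover have "inj_on \<tau> {..<K}"
    using bij_betw_imp_inj_on[OF \<tau>(1)] by (rule inj_on_subset) (use assms(2) in auto)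
  ultimately have "card {s \<in> S. s < \<tau> K} = K" by (simp add: card_image)
  then show ?thesis ..
qed


section \<open>The shift construction\<close>

definition vertex :: "nat \<Rightarrow> nat set \<Rightarrow> nat" where
  "vertex x S = prod_encode (x, set_encode S)"

definition vertex_point :: "nat \<Rightarrow> nat" where
  "vertex_point v = fst (prod_decode v)"

definition vertex_set :: "nat \<Rightarrow> nat set" where
  "vertex_set v = set_decode (snd (prod_decode v))"

lemma vertex_point_vertex [simp]: "vertex_point (vertex x S) = x"
  by (simp add: vertex_point_def vertex_def)

lemma vertex_set_vertex [simp]: "finite S \<Longrightarrow> vertex_set (vertex x S) = S"
  by (simp add: vertex_set_def vertex_def)

definition window :: "bool \<Rightarrow> nat \<Rightarrow> nat \<Rightarrow> nat set" where
  "window b k j = (if b then {j..<j + k} else {0..<0 + k})"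

lemma finite_window [simp]: "finite (window b k j)" and card_window [simp]: "card (window b k j) = k"
  by (simp_all add: window_def)

lemma window_subset: "j \<le> d \<Longrightarrow> window b k j \<subseteq> {..<k + d}"
  by (auto simp: window_def)

text \<open>
  A cover of \<open>X\<close>: each element of \<open>X\<close> is multiplied by the \<open>k\<close>-subsets of \<open>{..<N}\<close>. Over a tuple that
  satisfies \<open>P\<close>, the subset moves along an increasing sequence from one entry to the next, as in a
  shift graph; over the other tuples it stays the same.
\<close>

definition shift_structure ::
    "('i \<Rightarrow> nat list \<Rightarrow> bool) \<Rightarrow> nat \<Rightarrow> nat \<Rightarrow> nat \<Rightarrow> ('i, nat) rel_structure \<Rightarrow> ('i, nat) rel_structure"
  where "shift_structure P N k d X =
    \<lparr>base = {vertex x S | x S. x \<in> base X \<and> S \<subseteq> {..<N} \<and> card S = k},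
     rel = (\<lambda>i. {map (\<lambda>j. vertex (u ! j) (\<tau> ` window (P i u) k j)) [0..<length u] | u \<tau>.
       u \<in> rel X i \<and> strict_mono_on {..<k + d} \<tau> \<and> \<tau> ` {..<k + d} \<subseteq> {..<N}})\<rparr>"

lemma shift_tuple:
  assumes "t \<in> rel (shift_structure P N k d X) i"
  obtains u \<tau> where "u \<in> rel X i" "strict_mono_on {..<k + d} \<tau>" "\<tau> ` {..<k + d} \<subseteq> {..<N}"
    "map vertex_point t = u" "length t = length u"
    "\<And>j. j < length t \<Longrightarrow> t ! j = vertex (u ! j) (\<tau> ` window (P i u) k j)"
    "\<And>j. j < length t \<Longrightarrow> vertex_set (t ! j) = \<tau> ` window (P i u) k j"
proof -
  from assms obtain u \<tau> where u: "u \<in> rel X i" "strict_mono_on {..<k + d} \<tau>"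
    "\<tau> ` {..<k + d} \<subseteq> {..<N}"
    and t: "t = map (\<lambda>j. vertex (u ! j) (\<tau> ` window (P i u) k j)) [0..<length u]"
    by (auto simp: shift_structure_def)
  have "map vertex_point t = u" by (auto simp: t intro: nth_equalityI)
  with u t show thesis by (intro that) auto
qed

lemma is_structure_shift:
  assumes X: "is_structure I \<delta> X" and d: "\<And>i. i \<in> I \<Longrightarrow> \<delta> i \<le> d" and N: "k \<le> N"
  shows "is_structure I \<delta> (shift_structure P N k d X)" (is "is_structure I \<delta> ?Y")
  unfolding is_structure_def
proof (intro conjI ballI allI impI subsetI)
  have "base ?Y \<subseteq> (\<lambda>(x, S). vertex x S) ` (base X \<times> Pow {..<N})"
    by (auto simp: shift_structure_def)
  then show "finite (base ?Y)"
    by (rule finite_subset) (use X in \<open>simp add: is_structure_def\<close>)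
  from X obtain x where "x \<in> base X" by (auto simp: is_structure_def)
  moreover have "{..<k} \<subseteq> {..<N}" "card {..<k} = k" using N by auto
  ultimately have "vertex x {..<k} \<in> base ?Y" unfolding shift_structure_def by fastforce
  then show "base ?Y \<noteq> {}" by blast
  fix i
  {
    fix t assume i: "i \<in> I" and t: "t \<in> rel ?Y i"
    from t obtain u \<tau> where u: "u \<in> rel X i" "strict_mono_on {..<k + d} \<tau>"
      "\<tau> ` {..<k + d} \<subseteq> {..<N}" "length t = length u"
      "\<And>j. j < length t \<Longrightarrow> t ! j = vertex (u ! j) (\<tau> ` window (P i u) k j)"
      by (rule shift_tuple) (rule that)
    have len: "length u = \<delta> i" and sub: "set u \<subseteq> base X" using structure_tuple[OF X i u(1)] .
    have "t ! j \<in> base ?Y" if "j < length t" for j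
    proof -
      have w: "window (P i u) k j \<subseteq> {..<k + d}"
        using that u(4) len d[OF i] by (intro window_subset) simp
      have "card (\<tau> ` window (P i u) k j) = k"
        using inj_on_subset[OF strict_mono_on_imp_inj_on[OF u(2)] w] by (simp add: card_image)
      moreover have "\<tau> ` window (P i u) k j \<subseteq> {..<N}" using w u(3) by blast
      moreover have "u ! j \<in> base X" using that u(4) sub by (simp add: subset_iff)
      ultimately show ?thesis using u(5)[OF that] by (auto simp: shift_structure_def)
    qed
    then have "set t \<subseteq> base ?Y" by (auto simp: in_set_conv_nth)
    then show "t \<in> {t. length t = \<delta> i \<and> set t \<subseteq> base ?Y}" using len u(4) by simp
  next
    assume "i \<notin> I"
    then have "rel X i = {}" using X by (simp add: is_structure_def)
    then show "rel ?Y i = {}" by (simp add: shift_structure_def)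
  }
qed

lemma is_hom_shift: "is_hom I (shift_structure P N k d X) X vertex_point"
proof -
  have "map vertex_point t \<in> rel X i" if "t \<in> rel (shift_structure P N k d X) i" for i t
    using that by (rule shift_tuple) simp
  moreover have "vertex_point ` base (shift_structure P N k d X) \<subseteq> base X"
    by (auto simp: shift_structure_def)
  ultimately show ?thesis unfolding is_hom_def by blast
qed

text \<open>
  A homomorphism from the cover to \<open>Z\<close> colours the \<open>k\<close>-subsets of \<open>{..<N}\<close> by maps from \<open>X\<close> to \<open>Z\<close>. By
  Ramsey's theorem the colour is constant on the \<open>k\<close>-subsets of some \<open>H\<close> of size \<open>k + d\<close>, which has room
  for a copy of each tuple of \<open>X\<close>; so the common colour is a homomorphism.
\<close>

lemma hom_from_shift:
  assumes X: "is_structure I \<delta> X" and Z: "is_structure I \<delta> Z" and d: "\<And>i. i \<in> I \<Longrightarrow> \<delta> i \<le> d"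
    and ramsey: "partn_lst {..<N} (replicate C (k + d)) k"
    and C: "card (base Z) ^ card (base X) \<le> C"
    and hom: "hom_to I (shift_structure P N k d X) Z"
  shows "hom_to I X Z"
proof -
  let ?Y = "shift_structure P N k d X"
  from hom obtain g where g: "is_hom I ?Y Z g" by (auto simp: hom_to_def)
  define F where "F S = restrict (\<lambda>x. g (vertex x S)) (base X)" for S
  define T where "T = base X \<rightarrow>\<^sub>E base Z"
  have fin: "finite (base X)" "finite (base Z)" using X Z by (auto simp: is_structure_def)
  then have T: "finite T" "card T \<le> C" using C by (auto simp: T_def finite_PiE card_funcsetE)
  obtain \<phi> where \<phi>: "bij_betw \<phi> T {0..<card T}" using ex_bij_betw_finite_nat[OF T(1)] by blast
  have FT: "F S \<in> T" if "S \<in> nsets {..<N} k" for S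
  proof -
    have "vertex x S \<in> base ?Y" if "x \<in> base X" for x
      using that \<open>S \<in> nsets {..<N} k\<close> by (auto simp: nsets_def shift_structure_def)
    then show ?thesis using g by (auto simp: F_def T_def is_hom_def)
  qed
  have \<phi>F: "(\<lambda>S. \<phi> (F S)) \<in> nsets {..<N} k \<rightarrow> {..<C}"
  proof (rule funcsetI)
    fix S assume "S \<in> nsets {..<N} k"
    then have "\<phi> (F S) \<in> {0..<card T}" using bij_betwE[OF \<phi>] FT by blast
    then show "\<phi> (F S) \<in> {..<C}" using T(2) by simp
  qed
  obtain l H where l: "l < C" "H \<in> nsets {..<N} (replicate C (k + d) ! l)"
      "(\<lambda>S. \<phi> (F S)) ` nsets H k \<subseteq> {l}"
    using partn_lstE[OF ramsey \<phi>F] by auto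
  then have H: "H \<subseteq> {..<N}" "finite H" "card H = k + d" by (auto simp: nsets_def)
  have same: "F S = F S'" if "S \<in> nsets H k" "S' \<in> nsets H k" for S S'
  proof -
    have "\<phi> (F S) = \<phi> (F S')" using l(3) that by blast
    moreover have "F S \<in> T" "F S' \<in> T" using that H(1) by (auto intro!: FT simp: nsets_def)
    ultimately show ?thesis using bij_betw_imp_inj_on[OF \<phi>] by (auto dest: inj_onD)
  qed
  obtain \<tau> where \<tau>: "bij_betw \<tau> {..<k + d} H" and mono: "strict_mono_on {..<k + d} \<tau>"
    using ex_bij_betw_strict_mono_card[OF H(2)] unfolding H(3) .
  have im: "\<tau> ` {..<k + d} = H" using bij_betw_imp_surj_on[OF \<tau>] .
  have win: "\<tau> ` window b k j \<in> nsets H k" if "j \<le> d" for b j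
  proof -
    have w: "window b k j \<subseteq> {..<k + d}" using that by (rule window_subset)
    have "card (\<tau> ` window b k j) = k"
      using inj_on_subset[OF strict_mono_on_imp_inj_on[OF mono] w] by (simp add: card_image)
    then show ?thesis using w im by (auto simp: nsets_def)
  qed
  define S0 where "S0 = \<tau> ` window False k 0"
  have S0: "S0 \<in> nsets H k" unfolding S0_def by (rule win) simp
  have const: "g (vertex x S) = g (vertex x S0)" if "x \<in> base X" "S \<in> nsets H k" for x S
    using fun_cong[OF same[OF that(2) S0], of x] that(1) by (simp add: F_def)
  have "is_hom I X Z (\<lambda>x. g (vertex x S0))"
    unfolding is_hom_def
  proof (intro conjI ballI subsetI)
    fix z assume "z \<in> (\<lambda>x. g (vertex x S0)) ` base X"
    then obtain x where x: "x \<in> base X" "z = g (vertex x S0)" by blast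
    have "vertex x S0 \<in> base ?Y"
      using x(1) S0 H(1) by (auto simp: shift_structure_def nsets_def)
    then show "z \<in> base Z" using g x(2) by (auto simp: is_hom_def)
  next
    fix i t' assume i: "i \<in> I" and "t' \<in> map (\<lambda>x. g (vertex x S0)) ` rel X i"
    then obtain u where u: "u \<in> rel X i" "t' = map (\<lambda>x. g (vertex x S0)) u" by blast
    define t where "t = map (\<lambda>j. vertex (u ! j) (\<tau> ` window (P i u) k j)) [0..<length u]"
    have "t \<in> rel ?Y i" using u(1) mono im H(1) by (auto simp: shift_structure_def t_def)
    then have "map g t \<in> rel Z i" using is_hom_tuple[OF g i] by blast
    moreover have "map g t = t'"
    proof (rule nth_equalityI)
      show "length (map g t) = length t'" by (simp add: t_def u(2))
      fix j assume "j < length (map g t)"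
      then have j: "j < length u" by (simp add: t_def)
      have "u ! j \<in> base X" "j \<le> d"
        using structure_tuple[OF X i u(1)] j d[OF i] by auto
      then show "map g t ! j = t' ! j"
        using j const[of "u ! j"] win by (simp add: t_def u(2))
    qed
    ultimately show "t' \<in> rel Z i" by simp
  qed
  then show ?thesis by (auto simp: hom_to_def)
qed

text \<open>
  The level of a vertex is the number of elements of its subset below a threshold. Along a tuple it
  changes only by the shift, unless it is truncated at \<open>0\<close> or at the size of the subset. To avoid
  this, each connected component of \<open>Q\<close> takes a threshold that splits the subset of one of its
  vertices into halves of size \<open>K\<close>. Two vertices of a component are at most \<open>n * n\<close> tuples apart and a
  tuple changes the level by at most \<open>d\<close>; hence the choice of \<open>K\<close>.
\<close>

lemma shift_levels:
  fixes Q :: "('i, nat) rel_structure"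
  assumes X: "is_structure I \<delta> X" and d: "\<And>i. i \<in> I \<Longrightarrow> \<delta> i \<le> d" and "0 < d"
    and K: "K = d * (n * n) + d"
    and Q: "is_structure I \<delta> Q" "card (base Q) \<le> n"
    and emb: "is_hom I Q (shift_structure P N (2 * K) d X) (\<lambda>x. x)"
  shows "\<exists>l :: nat \<Rightarrow> nat. \<forall>i\<in>I. \<forall>t\<in>rel Q i.
    if P i (map vertex_point t) then distinct (map l t) else \<forall>x\<in>set t. \<forall>y\<in>set t. l x = l y"
proof -
  let ?Y = "shift_structure P N (2 * K) d X"
  define below where "below \<theta> v = card {s \<in> vertex_set v. s < \<theta>}" for \<theta> v
  define R where "R = {(u, v). \<exists>i\<in>I. \<exists>t\<in>rel Q i. u \<in> set t \<and> v \<in> set t}"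
  have finQ: "finite (base Q)" using Q(1) by (simp add: is_structure_def)
  have R: "R \<subseteq> base Q \<times> base Q"
    using structure_tuple(2)[OF Q(1)] unfolding R_def by blast
  then have finR: "finite R" using finite_cartesian_product[OF finQ finQ] by (rule finite_subset)
  have "card R \<le> card (base Q) * card (base Q)"
    using card_mono[OF _ R] finQ by (simp add: card_cartesian_product)
  also have "\<dots> \<le> n * n" using Q(2) Q(2) by (rule mult_le_mono)
  finally have cardR: "card R \<le> n * n" .
  have "sym R" unfolding R_def sym_def by blast
  then have symR: "sym (R\<^sup>*)" by (rule sym_rtrancl)
  have shape: "\<exists>\<tau>. strict_mono_on {..<2 * K + d} \<tau> \<and> length t \<le> d \<and>
      (\<forall>j<length t. vertex_set (t ! j) = \<tau> ` window (P i (map vertex_point t)) (2 * K) j)"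
    if "i \<in> I" "t \<in> rel Q i" for i t
  proof -
    have "t \<in> rel ?Y i" using is_hom_tuple[OF emb that] by simp
    moreover have "length t \<le> d" using structure_tuple(1)[OF Q(1) that] d[OF that(1)] by simp
    ultimately show ?thesis by (metis shift_tuple)
  qed
  have window_below: "below \<theta> (t ! j) = min (2 * K) (q - (if b then j else 0))"
    if "strict_mono_on {..<2 * K + d} \<tau>" "length t \<le> d" "j < length t"
      "vertex_set (t ! j) = \<tau> ` window b (2 * K) j"
      "q = card {p. p < 2 * K + d \<and> \<tau> p < \<theta>}" for \<theta> t j \<tau> b q
    unfolding below_def that(4,5) window_def
    using card_window_below[OF that(1), of j "2 * K"] card_window_below[OF that(1), of 0 "2 * K"]
      that(2,3) by simp
  have near: "below \<theta> u \<le> below \<theta> v + d" if "(u, v) \<in> R" for u v \<theta>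
  proof -
    from that obtain i t where t: "i \<in> I" "t \<in> rel Q i" "u \<in> set t" "v \<in> set t"
      unfolding R_def by blast
    then obtain j j' where j: "j < length t" "u = t ! j" "j' < length t" "v = t ! j'"
      by (metis in_set_conv_nth)
    from shape[OF t(1,2)] obtain \<tau> where \<tau>: "strict_mono_on {..<2 * K + d} \<tau>" "length t \<le> d"
      "\<And>j. j < length t \<Longrightarrow> vertex_set (t ! j) = \<tau> ` window (P i (map vertex_point t)) (2 * K) j"
      by blast
    show ?thesis
      unfolding j(2,4) window_below[OF \<tau>(1,2) j(1) \<tau>(3)[OF j(1)] refl]
        window_below[OF \<tau>(1,2) j(3) \<tau>(3)[OF j(3)] refl]
      using j(1,3) \<tau>(2) by (auto simp: min_def)
  qed
  have far: "below \<theta> u \<le> below \<theta> v + d * m" if "(u, v) \<in> R ^^ m" for u v \<theta> m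
    using that
  proof (induction m arbitrary: v)
    case (Suc m)
    then obtain w where w: "(u, w) \<in> R ^^ m" "(w, v) \<in> R" by auto
    show ?case using Suc.IH[OF w(1)] near[OF w(2), of \<theta>] by simp
  qed simp
  have reach: "below \<theta> u \<le> below \<theta> v + d * (n * n)" if "(u, v) \<in> R\<^sup>*" for u v \<theta>
  proof -
    from that obtain m where m: "m \<le> card R" "(u, v) \<in> R ^^ m"
      unfolding rtrancl_finite_eq_relpow[OF finR] by blast
    have "d * m \<le> d * (n * n)" using m(1) cardR by simp
    then show ?thesis using far[OF m(2), of \<theta>] by linarith
  qed
  \<comment> \<open>one representative of each connected component\<close>
  define rep where "rep v = (LEAST r. (v, r) \<in> R\<^sup>*)" for v
  have rep: "(v, rep v) \<in> R\<^sup>*" for v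
    unfolding rep_def by (rule LeastI[of _ v]) simp
  have rep_eq: "rep u = rep v" if "(u, v) \<in> R" for u v
  proof -
    have "(u, v) \<in> R\<^sup>*" "(v, u) \<in> R\<^sup>*" using that symR by (auto dest: symD)
    then have "(u, r) \<in> R\<^sup>* \<longleftrightarrow> (v, r) \<in> R\<^sup>*" for r by (meson rtrancl_trans)
    then show ?thesis by (simp add: rep_def)
  qed
  have rep_base: "rep v \<in> base Q" if "v \<in> base Q" for v
    using rep[of v] R that by (metis SigmaD2 rtranclE subsetD)
  have "\<exists>\<theta>. below \<theta> v = K" if "v \<in> base Q" for v
  proof -
    have "v \<in> base ?Y" using emb that by (auto simp: is_hom_def)
    then obtain x S where S: "S \<subseteq> {..<N}" "card S = 2 * K" "v = vertex x S"
      by (auto simp: shift_structure_def)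
    then have "finite S" using finite_subset by blast
    then show ?thesis
      unfolding below_def using S(2,3) threshold_exists[of S K] K \<open>0 < d\<close> by simp
  qed
  then obtain th where th: "\<And>v. v \<in> base Q \<Longrightarrow> below (th v) v = K" by metis
  define l where "l v = below (th (rep v)) v" for v
  have l_le: "l v + d \<le> 2 * K" and l_ge: "d \<le> l v" if "v \<in> base Q" for v
  proof -
    have "below (th (rep v)) (rep v) = K" using th rep_base that by blast
    moreover have "(rep v, v) \<in> R\<^sup>*" using rep symR by (auto dest: symD)
    ultimately show "l v + d \<le> 2 * K" "d \<le> l v"
      using reach[OF rep[of v], of "th (rep v)"] reach[of "rep v" v "th (rep v)"] K
      by (simp_all add: l_def)
  qed
  have "if P i (map vertex_point t) then distinct (map l t) else \<forall>x\<in>set t. \<forall>y\<in>set t. l x = l y"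
    if t: "i \<in> I" "t \<in> rel Q i" for i t
  proof -
    let ?b = "P i (map vertex_point t)"
    from shape[OF t] obtain \<tau> where \<tau>: "strict_mono_on {..<2 * K + d} \<tau>" "length t \<le> d"
      "\<And>j. j < length t \<Longrightarrow> vertex_set (t ! j) = \<tau> ` window ?b (2 * K) j"
      by blast
    have sub: "set t \<subseteq> base Q" using structure_tuple(2)[OF Q(1) t] .
    show ?thesis
    proof (cases "t = []")
      case False
      define \<theta> where "\<theta> = th (rep (t ! 0))"
      define q where "q = card {p. p < 2 * K + d \<and> \<tau> p < \<theta>}"
      have l: "l (t ! j) = min (2 * K) (q - (if ?b then j else 0))" if j: "j < length t" for j
      proof -
        have "t ! 0 \<in> set t" "t ! j \<in> set t" using j False by auto
        then have "(t ! 0, t ! j) \<in> R" using t unfolding R_def by blast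
        then have "l (t ! j) = below \<theta> (t ! j)" by (simp add: l_def \<theta>_def rep_eq)
        then show ?thesis using window_below[OF \<tau>(1,2) j \<tau>(3)[OF j] q_def] by simp
      qed
      have range: "d \<le> l (t ! j)" "l (t ! j) + d \<le> 2 * K" if "j < length t" for j
      proof -
        have "t ! j \<in> base Q" using that sub by auto
        then show "d \<le> l (t ! j)" "l (t ! j) + d \<le> 2 * K" by (rule l_ge, rule l_le)
      qed
      show ?thesis
      proof (cases ?b)
        case True
        have "l (t ! j) \<noteq> l (t ! j')" if "j < length t" "j' < length t" "j \<noteq> j'" for j j'
          using l[OF that(1)] l[OF that(2)] range[OF that(1)] range[OF that(2)] that True \<tau>(2)
          by (auto simp: min_def split: if_splits)
        then have "distinct (map l t)" unfolding distinct_conv_nth by simp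
        then show ?thesis by (simp only: True if_True)
      next
        case False
        have "l x = min (2 * K) q" if "x \<in> set t" for x
        proof -
          from that obtain j where "j < length t" "x = t ! j" by (metis in_set_conv_nth)
          then show ?thesis using l[of j] by (simp only: False if_False diff_zero)
        qed
        then have "\<forall>x\<in>set t. \<forall>y\<in>set t. l x = l y" by metis
        then show ?thesis by (simp only: False if_False)
      qed
    qed simp
  qed
  then show ?thesis by blast
qed

text \<open>
  The properties of the cover that matter: small structures cannot tell it from \<open>X\<close> as targets of
  homomorphisms, but its small substructures are cut at the tuples over \<open>P\<close>.
\<close>

lemma shift_cover:
  fixes X :: "('i, nat) rel_structure" and P :: "'i \<Rightarrow> nat list \<Rightarrow> bool"
  assumes type: "finite I" and X: "is_structure I \<delta> X"
  obtains Y :: "('i, nat) rel_structure" and \<pi> where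
    "is_structure I \<delta> Y" "is_hom I Y X \<pi>"
    "\<And>Z :: ('i, nat) rel_structure. is_structure I \<delta> Z \<Longrightarrow> card (base Z) \<le> n \<Longrightarrow>
       hom_to I Y Z \<Longrightarrow> hom_to I X Z"
    "\<And>Q :: ('i, nat) rel_structure. is_structure I \<delta> Q \<Longrightarrow> card (base Q) \<le> n \<Longrightarrow>
       is_hom I Q Y (\<lambda>x. x) \<Longrightarrow> \<exists>l :: nat \<Rightarrow> nat. \<forall>i\<in>I. \<forall>t\<in>rel Q i.
         if P i (map \<pi> t) then distinct (map l t) else \<forall>x\<in>set t. \<forall>y\<in>set t. l x = l y"
proof -
  \<comment> \<open>a common bound for the arities, positive also when \<open>I\<close> is empty\<close>
  define d where "d = Suc (sum \<delta> I)"
  have d: "\<delta> i \<le> d" if "i \<in> I" for i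
    using member_le_sum[OF that, of \<delta>] type by (simp add: d_def)
  define K where "K = d * (n * n) + d"
  define C where "C = n ^ card (base X)"
  obtain N0 :: nat where "partn_lst {..<N0} (replicate C (2 * K + d)) (2 * K)"
    using ramsey_full[of "replicate C (2 * K + d)" "2 * K"] by blast
  then have ramsey: "partn_lst {..<max N0 (2 * K)} (replicate C (2 * K + d)) (2 * K)"
    by (rule partn_lst_greater_resource) simp
  show thesis
  proof (rule that)
    show "is_structure I \<delta> (shift_structure P (max N0 (2 * K)) (2 * K) d X)"
      by (rule is_structure_shift[OF X d]) auto
    show "is_hom I (shift_structure P (max N0 (2 * K)) (2 * K) d X) X vertex_point"
      by (rule is_hom_shift)
  next
    fix Z :: "('i, nat) rel_structure"
    assume Z: "is_structure I \<delta> Z" "card (base Z) \<le> n"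
      "hom_to I (shift_structure P (max N0 (2 * K)) (2 * K) d X) Z"
    show "hom_to I X Z"
      by (rule hom_from_shift[OF X Z(1) d ramsey _ Z(3)]) (simp_all add: C_def Z(2) power_mono)
  next
    fix Q :: "('i, nat) rel_structure"
    assume Q: "is_structure I \<delta> Q" "card (base Q) \<le> n"
      "is_hom I Q (shift_structure P (max N0 (2 * K)) (2 * K) d X) (\<lambda>x. x)"
    show "\<exists>l :: nat \<Rightarrow> nat. \<forall>i\<in>I. \<forall>t\<in>rel Q i. if P i (map vertex_point t)
        then distinct (map l t) else \<forall>x\<in>set t. \<forall>y\<in>set t. l x = l y"
      by (rule shift_levels[OF X d _ K_def Q]) (auto simp: d_def)
  qed
qed


section \<open>Sparse incomparability\<close>

text \<open>
  The shift construction is iterated, once for each \<open>e\<close> in \<open>E\<close>, always with the tuples that lie over \<open>e\<close>.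
  Levels obtained earlier are pulled back along the later projections.
\<close>

lemma edges_cover:
  fixes X :: "('i, nat) rel_structure"
  assumes type: "finite I" and X: "is_structure I \<delta> X" and E: "finite E"
  shows "\<exists>(Y :: ('i, nat) rel_structure) \<pi>. is_structure I \<delta> Y \<and> is_hom I Y X \<pi> \<and>
    (\<forall>Z :: ('i, nat) rel_structure. is_structure I \<delta> Z \<longrightarrow> card (base Z) \<le> n \<longrightarrow>
       hom_to I Y Z \<longrightarrow> hom_to I X Z) \<and>
    (\<forall>Q :: ('i, nat) rel_structure. is_structure I \<delta> Q \<longrightarrow> card (base Q) \<le> n \<longrightarrow>
       is_hom I Q Y (\<lambda>x. x) \<longrightarrow> (\<forall>e\<in>E. \<exists>l :: nat \<Rightarrow> nat. \<forall>i\<in>I. \<forall>t\<in>rel Q i.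
         if (i, map \<pi> t) = e then distinct (map l t) else \<forall>x\<in>set t. \<forall>y\<in>set t. l x = l y))"
  using E
proof (induction E rule: finite_induct)
  case empty
  show ?case using X by (intro exI[of _ X] exI[of _ "\<lambda>x. x"]) simp
next
  case (insert e E)
  then obtain Y :: "('i, nat) rel_structure" and \<pi> where Y: "is_structure I \<delta> Y" "is_hom I Y X \<pi>"
    and presY: "\<And>Z :: ('i, nat) rel_structure. is_structure I \<delta> Z \<Longrightarrow> card (base Z) \<le> n \<Longrightarrow>
       hom_to I Y Z \<Longrightarrow> hom_to I X Z"
    and levY: "\<And>(Q :: ('i, nat) rel_structure) e. is_structure I \<delta> Q \<Longrightarrow> card (base Q) \<le> n \<Longrightarrow>
       is_hom I Q Y (\<lambda>x. x) \<Longrightarrow> e \<in> E \<Longrightarrow> \<exists>l :: nat \<Rightarrow> nat. \<forall>i\<in>I. \<forall>t\<in>rel Q i.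
         if (i, map \<pi> t) = e then distinct (map l t) else \<forall>x\<in>set t. \<forall>y\<in>set t. l x = l y"
    by blast
  obtain Y' :: "('i, nat) rel_structure" and \<rho> where Y': "is_structure I \<delta> Y'" "is_hom I Y' Y \<rho>"
    and presY': "\<And>Z :: ('i, nat) rel_structure. is_structure I \<delta> Z \<Longrightarrow> card (base Z) \<le> n \<Longrightarrow>
       hom_to I Y' Z \<Longrightarrow> hom_to I Y Z"
    and levY': "\<And>Q :: ('i, nat) rel_structure. is_structure I \<delta> Q \<Longrightarrow> card (base Q) \<le> n \<Longrightarrow>
       is_hom I Q Y' (\<lambda>x. x) \<Longrightarrow> \<exists>l :: nat \<Rightarrow> nat. \<forall>i\<in>I. \<forall>t\<in>rel Q i.
         if (i, map \<pi> (map \<rho> t)) = e then distinct (map l t) else \<forall>x\<in>set t. \<forall>y\<in>set t. l x = l y"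
    by (rule shift_cover[OF type Y(1), of n "\<lambda>i t. (i, map \<pi> t) = e"]) (rule that)
  have "\<exists>l :: nat \<Rightarrow> nat. \<forall>i\<in>I. \<forall>t\<in>rel Q i. if (i, map (\<lambda>x. \<pi> (\<rho> x)) t) = e'
      then distinct (map l t) else \<forall>x\<in>set t. \<forall>y\<in>set t. l x = l y"
    if Q: "is_structure I \<delta> Q" "card (base Q) \<le> n" "is_hom I Q Y' (\<lambda>x. x)" and "e' \<in> insert e E"
    for Q :: "('i, nat) rel_structure" and e'
  proof (cases "e' = e")
    case True
    then show ?thesis using levY'[OF Q] by (simp add: comp_def)
  next
    case False
    with that(4) have e': "e' \<in> E" by simp
    let ?Q = "image_structure \<rho> Q"
    have "is_structure I \<delta> ?Q" using Q(1) by (rule is_structure_image)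
    moreover have "card (base ?Q) \<le> n"
      using Q(1,2) card_image_le[of "base Q" \<rho>] by (auto simp: is_structure_def)
    moreover have "is_hom I ?Q Y (\<lambda>x. x)"
      by (rule is_hom_from_image[OF Q(1) is_hom_comp[OF Q(3) Y'(2)]]) simp
    ultimately obtain l :: "nat \<Rightarrow> nat" where l: "\<forall>i\<in>I. \<forall>t\<in>rel ?Q i.
        if (i, map \<pi> t) = e' then distinct (map l t) else \<forall>x\<in>set t. \<forall>y\<in>set t. l x = l y"
      using levY e' by blast
    show ?thesis
    proof (intro exI[of _ "\<lambda>x. l (\<rho> x)"] ballI)
      fix i t assume i: "i \<in> I" and t: "t \<in> rel Q i"
      then have "map \<rho> t \<in> rel ?Q i" by simp
      note lt = bspec[OF bspec[OF l i] this]
      have 1: "map \<pi> (map \<rho> t) = map (\<lambda>x. \<pi> (\<rho> x)) t" by simp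
      have 2: "map l (map \<rho> t) = map (\<lambda>x. l (\<rho> x)) t" by simp
      show "if (i, map (\<lambda>x. \<pi> (\<rho> x)) t) = e' then distinct (map (\<lambda>x. l (\<rho> x)) t)
          else \<forall>x\<in>set t. \<forall>y\<in>set t. l (\<rho> x) = l (\<rho> y)"
        using lt unfolding 1 2 set_map by (simp only: ball_simps)
    qed
  qed
  moreover have "hom_to I X Z" if "is_structure I \<delta> Z" "card (base Z) \<le> n" "hom_to I Y' Z"
    for Z :: "('i, nat) rel_structure"
    using presY presY' that by blast
  ultimately show ?case
    using Y'(1) is_hom_comp[OF Y'(2) Y(2)]
    by (intro exI[of _ Y'] exI[of _ "\<lambda>x. \<pi> (\<rho> x)"]) blast
qed

text \<open>
  All tuples of \<open>X\<close> are cut at once. If \<open>\<pi>\<close> is injective on \<open>Q\<close>, then different tuples of \<open>Q\<close> lie over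
  different tuples of \<open>X\<close>, so the level that cuts the tuples over \<open>\<pi> t\<close> cuts only \<open>t\<close>: it is a bridge.
\<close>

lemma forest_cover:
  fixes X :: "('i, nat) rel_structure"
  assumes type: "finite I" and X: "is_structure I \<delta> X"
  obtains Y :: "('i, nat) rel_structure" and \<pi> where
    "is_structure I \<delta> Y" "is_hom I Y X \<pi>"
    "\<And>Z :: ('i, nat) rel_structure. is_structure I \<delta> Z \<Longrightarrow> card (base Z) \<le> n \<Longrightarrow>
       hom_to I Y Z \<Longrightarrow> hom_to I X Z"
    "\<And>Q :: ('i, nat) rel_structure. is_structure I \<delta> Q \<Longrightarrow> card (base Q) \<le> n \<Longrightarrow>
       is_hom I Q Y (\<lambda>x. x) \<Longrightarrow> inj_on \<pi> (base Q) \<Longrightarrow> is_forest I Q"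
proof -
  define E where "E = Sigma I (rel X)"
  have "finite E" unfolding E_def using type X by (rule finite_tuples)
  from edges_cover[OF type X this, of n]
  obtain Y :: "('i, nat) rel_structure" and \<pi> where Y: "is_structure I \<delta> Y" "is_hom I Y X \<pi>"
    and pres: "\<And>Z :: ('i, nat) rel_structure. is_structure I \<delta> Z \<Longrightarrow> card (base Z) \<le> n \<Longrightarrow>
       hom_to I Y Z \<Longrightarrow> hom_to I X Z"
    and lev: "\<And>(Q :: ('i, nat) rel_structure) e. is_structure I \<delta> Q \<Longrightarrow> card (base Q) \<le> n \<Longrightarrow>
       is_hom I Q Y (\<lambda>x. x) \<Longrightarrow> e \<in> E \<Longrightarrow> \<exists>l :: nat \<Rightarrow> nat. \<forall>i\<in>I. \<forall>t\<in>rel Q i.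
         if (i, map \<pi> t) = e then distinct (map l t) else \<forall>x\<in>set t. \<forall>y\<in>set t. l x = l y"
    by blast
  have "is_forest I Q"
    if Q: "is_structure I \<delta> Q" "card (base Q) \<le> n" "is_hom I Q Y (\<lambda>x. x)" and inj: "inj_on \<pi> (base Q)"
    for Q :: "('i, nat) rel_structure"
    unfolding is_forest_def
  proof (intro ballI)
    fix i t assume i: "i \<in> I" and t: "t \<in> rel Q i"
    have "map \<pi> t \<in> rel X i"
      using is_hom_tuple[OF is_hom_comp[OF Q(3) Y(2)] i t] by simp
    then have "(i, map \<pi> t) \<in> E" using i by (simp add: E_def)
    from lev[OF Q this] obtain l :: "nat \<Rightarrow> nat" where l: "\<forall>j\<in>I. \<forall>s\<in>rel Q j.
        if (j, map \<pi> s) = (i, map \<pi> t) then distinct (map l s)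
        else \<forall>x\<in>set s. \<forall>y\<in>set s. l x = l y" by blast
    have "\<forall>x\<in>set s. \<forall>y\<in>set s. l x = l y"
      if j: "j \<in> I" and s: "s \<in> rel Q j" and ne: "(j, s) \<noteq> (i, t)" for j s
    proof -
      have "map \<pi> s = map \<pi> t \<longleftrightarrow> s = t"
        using structure_tuple(2)[OF Q(1) i t] structure_tuple(2)[OF Q(1) j s]
        by (intro inj_on_map_eq_map inj_on_subset[OF inj]) blast
      then have "(j, map \<pi> s) \<noteq> (i, map \<pi> t)" using ne by blast
      then show ?thesis using bspec[OF bspec[OF l j] s] by (simp only: if_False)
    qed
    moreover have "distinct (map l t)" using bspec[OF bspec[OF l i] t] by (simp only: if_True refl)
    ultimately show "\<exists>c :: nat \<Rightarrow> nat. distinct (map c t) \<and> (\<forall>j\<in>I. \<forall>s\<in>rel Q j.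
        (j, s) \<noteq> (i, t) \<longrightarrow> (\<forall>x\<in>set s. \<forall>y\<in>set s. c x = c y))" by blast
  qed
  with Y pres show thesis using that by blast
qed

definition factors_through_forest ::
    "'i set \<Rightarrow> ('i \<Rightarrow> nat) \<Rightarrow> nat \<Rightarrow> ('i, nat) rel_structure \<Rightarrow> ('i, nat) rel_structure \<Rightarrow> bool" where
  "factors_through_forest I \<delta> n Q X \<longleftrightarrow> (\<exists>H :: ('i, nat) rel_structure.
     is_structure I \<delta> H \<and> is_forest I H \<and> base H \<subseteq> {..<n} \<and> hom_to I Q H \<and> hom_to I H X)"

lemma factors_through_forest_mono:
  assumes "factors_through_forest I \<delta> n Q X" "hom_to I P Q" "hom_to I X Y"
  shows "factors_through_forest I \<delta> n P Y"
  using assms unfolding factors_through_forest_def by (blast intro: hom_to_trans)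

text \<open>
  In a tower of covers, a small substructure \<open>Q\<close> of the top either is a forest, or is mapped
  noninjectively to the level below and loses an element. After \<open>m\<close> levels without a forest it has lost
  \<open>m\<close> elements.
\<close>

lemma sparse_cover_depth:
  fixes X :: "('i, nat) rel_structure"
  assumes type: "finite I" and X: "is_structure I \<delta> X"
  shows "\<exists>(Y :: ('i, nat) rel_structure) \<pi>. is_structure I \<delta> Y \<and> is_hom I Y X \<pi> \<and>
    (\<forall>Z :: ('i, nat) rel_structure. is_structure I \<delta> Z \<longrightarrow> card (base Z) \<le> n \<longrightarrow>
       hom_to I Y Z \<longrightarrow> hom_to I X Z) \<and>
    (\<forall>Q :: ('i, nat) rel_structure. is_structure I \<delta> Q \<longrightarrow> card (base Q) \<le> n \<longrightarrow>
       is_hom I Q Y (\<lambda>x. x) \<longrightarrow>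
       factors_through_forest I \<delta> n Q X \<or> card (\<pi> ` base Q) + m \<le> card (base Q))"
proof (induction m)
  case 0
  show ?case using X by (intro exI[of _ X] exI[of _ "\<lambda>x. x"]) simp
next
  case (Suc m)
  then obtain Y :: "('i, nat) rel_structure" and \<pi> where Y: "is_structure I \<delta> Y" "is_hom I Y X \<pi>"
    and presY: "\<And>Z :: ('i, nat) rel_structure. is_structure I \<delta> Z \<Longrightarrow> card (base Z) \<le> n \<Longrightarrow>
       hom_to I Y Z \<Longrightarrow> hom_to I X Z"
    and smallY: "\<And>Q :: ('i, nat) rel_structure. is_structure I \<delta> Q \<Longrightarrow> card (base Q) \<le> n \<Longrightarrow>
       is_hom I Q Y (\<lambda>x. x) \<Longrightarrow>
       factors_through_forest I \<delta> n Q X \<or> card (\<pi> ` base Q) + m \<le> card (base Q)"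
    by blast
  obtain Y' :: "('i, nat) rel_structure" and \<rho> where Y': "is_structure I \<delta> Y'" "is_hom I Y' Y \<rho>"
    and presY': "\<And>Z :: ('i, nat) rel_structure. is_structure I \<delta> Z \<Longrightarrow> card (base Z) \<le> n \<Longrightarrow>
       hom_to I Y' Z \<Longrightarrow> hom_to I Y Z"
    and forY': "\<And>Q :: ('i, nat) rel_structure. is_structure I \<delta> Q \<Longrightarrow> card (base Q) \<le> n \<Longrightarrow>
       is_hom I Q Y' (\<lambda>x. x) \<Longrightarrow> inj_on \<rho> (base Q) \<Longrightarrow> is_forest I Q"
    by (rule forest_cover[OF type Y(1), of n]) (rule that)
  have "factors_through_forest I \<delta> n Q X \<or> card ((\<lambda>x. \<pi> (\<rho> x)) ` base Q) + Suc m \<le> card (base Q)"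
    if Q: "is_structure I \<delta> Q" "card (base Q) \<le> n" "is_hom I Q Y' (\<lambda>x. x)"
    for Q :: "('i, nat) rel_structure"
  proof -
    have fin: "finite (base Q)" using Q(1) by (simp add: is_structure_def)
    have QY: "is_hom I Q Y \<rho>" using is_hom_comp[OF Q(3) Y'(2)] .
    show ?thesis
    proof (cases "inj_on \<rho> (base Q)")
      case True
      then have "is_forest I Q" using forY' Q by blast
      then obtain H :: "('i, nat) rel_structure" where H: "is_structure I \<delta> H" "is_forest I H"
        "base H \<subseteq> {..<n}" "hom_to I Q H" "hom_to I H Q"
        using relabel[OF Q(1,2)] by metis
      have "hom_to I Q X" using is_hom_comp[OF QY Y(2)] by (auto simp: hom_to_def)
      with H show ?thesis unfolding factors_through_forest_def by (blast intro: hom_to_trans)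
    next
      case False
      let ?Q = "image_structure \<rho> Q"
      have less: "card (base ?Q) < card (base Q)"
        using False card_image_le[OF fin, of \<rho>] eq_card_imp_inj_on[OF fin, of \<rho>] by fastforce
      have "is_structure I \<delta> ?Q" using Q(1) by (rule is_structure_image)
      moreover have "card (base ?Q) \<le> n" using less Q(2) by simp
      moreover have "is_hom I ?Q Y (\<lambda>x. x)"
        by (rule is_hom_from_image[OF Q(1) QY]) simp
      ultimately have "factors_through_forest I \<delta> n ?Q X \<or>
          card (\<pi> ` base ?Q) + m \<le> card (base ?Q)"
        by (rule smallY)
      moreover have "hom_to I Q ?Q" using is_hom_image unfolding hom_to_def by blast
      ultimately show ?thesis
        using less factors_through_forest_mono[of I \<delta> n ?Q X Q X] hom_to_refl
        by (auto simp: image_image)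
    qed
  qed
  moreover have "hom_to I X Z" if "is_structure I \<delta> Z" "card (base Z) \<le> n" "hom_to I Y' Z"
    for Z :: "('i, nat) rel_structure"
    using presY presY' that by blast
  ultimately show ?case
    using Y'(1) is_hom_comp[OF Y'(2) Y(2)]
    by (intro exI[of _ Y'] exI[of _ "\<lambda>x. \<pi> (\<rho> x)"]) blast
qed

text \<open>
  The usual form of this lemma replaces \<open>X\<close> by a structure of large girth, in which small
  substructures are forests. The cover here may have short cycles, but they disappear in the
  homomorphic image \<open>H\<close>, which serves the same purpose.
\<close>

lemma sparse_incomparability:
  fixes X :: "('i, nat) rel_structure"
  assumes type: "finite I" and X: "is_structure I \<delta> X"
  obtains Y :: "('i, nat) rel_structure" where "is_structure I \<delta> Y" "hom_to I Y X"
    "\<And>Z :: ('i, nat) rel_structure. is_structure I \<delta> Z \<Longrightarrow> card (base Z) \<le> n \<Longrightarrow>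
       hom_to I Y Z \<Longrightarrow> hom_to I X Z"
    "\<And>Q :: ('i, nat) rel_structure. is_structure I \<delta> Q \<Longrightarrow> card (base Q) \<le> n \<Longrightarrow>
       hom_to I Q Y \<Longrightarrow> factors_through_forest I \<delta> n Q X"
proof -
  from sparse_cover_depth[OF type X, of n n]
  obtain Y :: "('i, nat) rel_structure" and \<pi> where Y: "is_structure I \<delta> Y" "is_hom I Y X \<pi>"
    and pres: "\<And>Z :: ('i, nat) rel_structure. is_structure I \<delta> Z \<Longrightarrow> card (base Z) \<le> n \<Longrightarrow>
       hom_to I Y Z \<Longrightarrow> hom_to I X Z"
    and small: "\<And>Q :: ('i, nat) rel_structure. is_structure I \<delta> Q \<Longrightarrow> card (base Q) \<le> n \<Longrightarrow>
       is_hom I Q Y (\<lambda>x. x) \<Longrightarrow>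
       factors_through_forest I \<delta> n Q X \<or> card (\<pi> ` base Q) + n \<le> card (base Q)"
    by blast
  have "factors_through_forest I \<delta> n Q X"
    if Q: "is_structure I \<delta> Q" "card (base Q) \<le> n" and QY: "hom_to I Q Y"
    for Q :: "('i, nat) rel_structure"
  proof -
    from QY obtain g where g: "is_hom I Q Y g" by (auto simp: hom_to_def)
    let ?Q = "image_structure g Q"
    have fin: "finite (base Q)" and ne: "base Q \<noteq> {}" using Q(1) by (auto simp: is_structure_def)
    have card: "card (base ?Q) \<le> n" using card_image_le[OF fin, of g] Q(2) by simp
    have "is_hom I ?Q Y (\<lambda>x. x)" by (rule is_hom_from_image[OF Q(1) g]) simp
    from small[OF is_structure_image[OF Q(1)] card this]
    have "factors_through_forest I \<delta> n ?Q X"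
    proof
      assume "card (\<pi> ` base ?Q) + n \<le> card (base ?Q)"
      then have "card (\<pi> ` base ?Q) = 0" using card by simp
      then show ?thesis using fin ne by simp
    qed
    moreover have "hom_to I Q ?Q" using is_hom_image unfolding hom_to_def by blast
    ultimately show ?thesis using hom_to_refl by (rule factors_through_forest_mono)
  qed
  moreover have "hom_to I Y X" using Y(2) by (auto simp: hom_to_def)
  ultimately show thesis using Y(1) pres that by blast
qed

text \<open>
  If a sparse cover of \<open>A\<close> maps to a member of \<open>Q\<close>, so does \<open>A\<close>; if a member of \<open>Q\<close> maps to the cover, it
  does so through a forest below \<open>A\<close>.
\<close>

lemma maximal_iff_forests:
  fixes Q :: "('i, nat) rel_structure set"
  assumes type: "finite I" and Q: "\<And>B. B \<in> Q \<Longrightarrow> is_structure I \<delta> B \<and> card (base B) \<le> n"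
  shows "(\<forall>A :: ('i, nat) rel_structure. is_structure I \<delta> A \<longrightarrow>
        (\<exists>B\<in>Q. hom_to I A B \<or> hom_to I B A)) \<longleftrightarrow>
    (\<forall>A :: ('i, nat) rel_structure. is_structure I \<delta> A \<longrightarrow>
        (\<exists>B\<in>Q. hom_to I A B \<or> factors_through_forest I \<delta> n B A))" (is "?L \<longleftrightarrow> ?R")
proof
  assume L: ?L
  show ?R
  proof (intro allI impI)
    fix A :: "('i, nat) rel_structure" assume A: "is_structure I \<delta> A"
    obtain A' :: "('i, nat) rel_structure" where A': "is_structure I \<delta> A'"
      "\<And>Z :: ('i, nat) rel_structure. is_structure I \<delta> Z \<Longrightarrow> card (base Z) \<le> n \<Longrightarrow>
         hom_to I A' Z \<Longrightarrow> hom_to I A Z"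
      "\<And>Q :: ('i, nat) rel_structure. is_structure I \<delta> Q \<Longrightarrow> card (base Q) \<le> n \<Longrightarrow>
         hom_to I Q A' \<Longrightarrow> factors_through_forest I \<delta> n Q A"
      by (rule sparse_incomparability[OF type A, of n]) (rule that)
    then obtain B where "B \<in> Q" "hom_to I A' B \<or> hom_to I B A'" using L by blast
    with A' Q show "\<exists>B\<in>Q. hom_to I A B \<or> factors_through_forest I \<delta> n B A" by blast
  qed
next
  assume ?R
  then show ?L unfolding factors_through_forest_def by (blast intro: hom_to_trans)
qed


section \<open>Quotients by types\<close>

definition pointed_structures ::
    "'i set \<Rightarrow> ('i \<Rightarrow> nat) \<Rightarrow> nat \<Rightarrow> (('i, nat) rel_structure \<times> nat) set" where
  "pointed_structures I \<delta> m = {(B, u). is_structure I \<delta> B \<and> base B \<subseteq> {..<m} \<and> u \<in> base B}"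

definition type_of ::
    "'i set \<Rightarrow> ('i \<Rightarrow> nat) \<Rightarrow> nat \<Rightarrow> ('i, 'a) rel_structure \<Rightarrow> 'a \<Rightarrow>
     (('i, nat) rel_structure \<times> nat) set" where
  "type_of I \<delta> m X a = {(B, u) \<in> pointed_structures I \<delta> m. \<exists>g. is_hom I B X g \<and> g u = a}"

text \<open>
  A map \<open>h\<close> from \<open>H\<close> to a quotient of \<open>X\<close> sends the bridge \<open>t\<close> to the image of some tuple \<open>s\<close> of \<open>X\<close>. The parts
  into which \<open>H\<close> falls without \<open>t\<close> are mapped to \<open>X\<close> independently, each with its entry of \<open>t\<close> going to the
  corresponding entry of \<open>s\<close>; together these maps are a homomorphism.
\<close>

lemma forest_lift_tuple:
  fixes H :: "('i, nat) rel_structure" and X :: "('i, 'a) rel_structure" and tp :: "'a \<Rightarrow> 'b"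
  assumes H: "is_structure I \<delta> H" "is_forest I H"
    and h: "is_hom I H (image_structure tp X) h"
    and t: "i \<in> I" "t \<in> rel H i"
    and H': "base H' = base H" "\<And>j. rel H' j = (if j = i then rel H i - {t} else rel H j)"
    and IH: "\<And>u a. u \<in> base H \<Longrightarrow> a \<in> base X \<Longrightarrow> tp a = h u \<Longrightarrow> \<exists>g. is_hom I H' X g \<and> g u = a"
    and X: "is_structure I \<delta> X"
  obtains g where "is_hom I H X g" "\<And>v. v \<in> set t \<Longrightarrow> tp (g v) = h v"
proof -
  have "map h t \<in> rel (image_structure tp X) i" using is_hom_tuple[OF h t] .
  then obtain s where s: "s \<in> rel X i" "map h t = map tp s" by auto
  have len: "length s = length t" using s(2) by (metis length_map)
  have sub: "set t \<subseteq> base H" "set s \<subseteq> base X"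
    using structure_tuple(2)[OF H(1) t] structure_tuple(2)[OF X t(1) s(1)] .
  have tp_s: "tp (s ! j) = h (t ! j)" if "j < length t" for j
    using that s(2) len by (metis nth_map)
  have "\<exists>g. is_hom I H' X g \<and> g (t ! j) = s ! j" if "j < length t" for j
    using that sub len tp_s by (intro IH) auto
  then obtain G where G: "\<And>j. j < length t \<Longrightarrow> is_hom I H' X (G j)"
    "\<And>j. j < length t \<Longrightarrow> G j (t ! j) = s ! j" by metis
  obtain G' where G': "is_hom I H' X G'"
  proof -
    obtain u where u: "u \<in> base H" using H(1) by (auto simp: is_structure_def)
    then have "h u \<in> tp ` base X" using h by (auto simp: is_hom_def)
    then obtain a where "a \<in> base X" "tp a = h u" by (metis imageE)
    then show thesis using IH[OF u] that by metis
  qed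
  obtain c :: "nat \<Rightarrow> nat" where c: "distinct (map c t)"
    "\<forall>j\<in>I. \<forall>s\<in>rel H j. (j, s) \<noteq> (i, t) \<longrightarrow> (\<forall>x\<in>set s. \<forall>y\<in>set s. c x = c y)"
    using bspec[OF bspec[OF H(2)[unfolded is_forest_def] t(1)] t(2)] by (elim exE conjE) (rule that)
  \<comment> \<open>Removing \<open>t\<close> splits \<open>H\<close> into parts with different colours; each part has its own map.\<close>
  define K where "K q = (if \<exists>j<length t. c (t ! j) = q
      then G (SOME j. j < length t \<and> c (t ! j) = q) else G')" for q
  have K: "is_hom I H' X (K q)" for q
  proof (cases "\<exists>j<length t. c (t ! j) = q")
    case True
    then have "(SOME j. j < length t \<and> c (t ! j) = q) < length t"
      by (rule someI2_ex) blast
    then show ?thesis using True G(1) by (simp add: K_def)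
  next
    case False
    then have "K q = G'" unfolding K_def by (rule if_not_P)
    then show ?thesis using G' by simp
  qed
  have K_t: "K (c (t ! j)) = G j" if j: "j < length t" for j
  proof -
    have "(SOME j'. j' < length t \<and> c (t ! j') = c (t ! j)) = j"
    proof (rule some_equality)
      fix j' assume "j' < length t \<and> c (t ! j') = c (t ! j)"
      then show "j' = j" using c(1) j nth_eq_iff_index_eq[of "map c t" j' j] by simp
    qed (use j in simp)
    then show ?thesis using j by (auto simp: K_def)
  qed
  define g where "g v = K (c v) v" for v
  have g_t: "map g t = s"
    using G(2) K_t len by (intro nth_equalityI) (simp_all add: g_def)
  have "is_hom I H X g"
    unfolding is_hom_def
  proof (intro conjI ballI subsetI)
    fix y assume "y \<in> g ` base H"
    then obtain v where "v \<in> base H" "y = K (c v) v" unfolding g_def by blast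
    then show "y \<in> base X" using K[of "c v"] H'(1) unfolding is_hom_def by blast
  next
    fix i' y assume i': "i' \<in> I" and "y \<in> map g ` rel H i'"
    then obtain t' where t': "t' \<in> rel H i'" "y = map g t'" by blast
    show "y \<in> rel X i'"
    proof (cases "(i', t') = (i, t)")
      case True
      then show ?thesis using g_t s(1) t'(2) by simp
    next
      case False
      then have in_H': "t' \<in> rel H' i'" using t'(1) H'(2)[of i'] by (auto split: if_splits)
      have "c v = c (hd t')" if "v \<in> set t'" for v
        using c(2)[rule_format, OF i' t'(1) False, of v "hd t'"] that hd_in_set[of t'] by fastforce
      then have "y = map (K (c (hd t'))) t'" unfolding t'(2) by (auto simp: g_def)
      then show ?thesis using is_hom_tuple[OF K i' in_H'] by blast
    qed
  qed
  moreover have "tp (g v) = h v" if "v \<in> set t" for v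
  proof -
    from that obtain j where j: "j < length t" "v = t ! j" by (metis in_set_conv_nth)
    have "g v = s ! j" using g_t j by (metis nth_map)
    then show ?thesis using tp_s j by simp
  qed
  ultimately show thesis by (rule that)
qed

text \<open>
  By induction on the number of tuples. Lifting at a tuple that contains \<open>u\<close> sends \<open>u\<close> to an element of the
  same type as \<open>a\<close>, though perhaps not to \<open>a\<close>; since \<open>H\<close> with the point \<open>u\<close> belongs to the structures that
  types record, there is then also a homomorphism with \<open>u\<close> going to \<open>a\<close>.
\<close>

lemma forest_lift:
  fixes X :: "('i, 'a) rel_structure" and H :: "('i, nat) rel_structure"
  assumes type: "finite I" and X: "is_structure I \<delta> X"
    and H: "is_structure I \<delta> H" "is_forest I H" "base H \<subseteq> {..<m}"
    and h: "is_hom I H (image_structure (type_of I \<delta> m X) X) h"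
    and u: "u \<in> base H" "a \<in> base X" "type_of I \<delta> m X a = h u"
  shows "\<exists>g. is_hom I H X g \<and> g u = a"
  using H h u
proof (induction "card (Sigma I (rel H))" arbitrary: H u a rule: less_induct)
  case less
  note H = \<open>is_structure I \<delta> H\<close> \<open>is_forest I H\<close> \<open>base H \<subseteq> {..<m}\<close>
  note h = \<open>is_hom I H (image_structure (type_of I \<delta> m X) X) h\<close>
  note u = \<open>u \<in> base H\<close> \<open>a \<in> base X\<close> \<open>type_of I \<delta> m X a = h u\<close>
  have lift: "\<exists>g. is_hom I H X g \<and> (\<forall>v\<in>set t. type_of I \<delta> m X (g v) = h v)"
    if t: "i \<in> I" "t \<in> rel H i" for i t
  proof -
    define H' where "H' = \<lparr>base = base H, rel = (\<lambda>j. if j = i then rel H i - {t} else rel H j)\<rparr>"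
    have H': "base H' = base H" "\<And>j. rel H' j = (if j = i then rel H i - {t} else rel H j)"
      by (simp_all add: H'_def)
    have sub: "rel H' j \<subseteq> rel H j" for j using H'(2)[of j] by auto
    have "Sigma I (rel H') \<subseteq> Sigma I (rel H)" using sub by auto
    moreover have "(i, t) \<in> Sigma I (rel H)" "(i, t) \<notin> Sigma I (rel H')"
      using t H'(2)[of i] by auto
    ultimately have "Sigma I (rel H') \<subset> Sigma I (rel H)" by blast
    then have less_card: "card (Sigma I (rel H')) < card (Sigma I (rel H))"
      using finite_tuples[OF type H(1)] by (rule psubset_card_mono[rotated])
    have sH': "is_structure I \<delta> H'" using H(1) sub unfolding is_structure_def H'(1) by blast
    have fH': "is_forest I H'"
      unfolding is_forest_def
    proof (intro ballI)
      fix j s assume j: "j \<in> I" and "s \<in> rel H' j"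
      then have s: "s \<in> rel H j" using sub by blast
      obtain c :: "nat \<Rightarrow> nat" where c: "distinct (map c s)" "\<forall>j'\<in>I. \<forall>s'\<in>rel H j'.
          (j', s') \<noteq> (j, s) \<longrightarrow> (\<forall>x\<in>set s'. \<forall>y\<in>set s'. c x = c y)"
        using bspec[OF bspec[OF H(2)[unfolded is_forest_def] j] s]
        by (elim exE conjE) (rule that)
      show "\<exists>c :: nat \<Rightarrow> nat. distinct (map c s) \<and> (\<forall>j'\<in>I. \<forall>s'\<in>rel H' j'.
          (j', s') \<noteq> (j, s) \<longrightarrow> (\<forall>x\<in>set s'. \<forall>y\<in>set s'. c x = c y))"
      proof (intro exI[of _ c] conjI ballI impI)
        fix j' s' x y
        assume "j' \<in> I" "s' \<in> rel H' j'" "(j', s') \<noteq> (j, s)" "x \<in> set s'" "y \<in> set s'"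
        then show "c x = c y" using c(2)[rule_format, of j' s' x y] sub[of j'] by blast
      qed (fact c(1))
    qed
    have hH': "is_hom I H' (image_structure (type_of I \<delta> m X) X) h"
      unfolding is_hom_def H'(1)
    proof (intro conjI ballI subsetI)
      fix y assume "y \<in> h ` base H"
      then show "y \<in> base (image_structure (type_of I \<delta> m X) X)" using h unfolding is_hom_def by blast
    next
      fix j y assume j: "j \<in> I" and "y \<in> map h ` rel H' j"
      then obtain s where "s \<in> rel H j" "y = map h s" using sub by blast
      then show "y \<in> rel (image_structure (type_of I \<delta> m X) X) j" using is_hom_tuple[OF h j] by blast
    qed
    have "\<exists>g. is_hom I H' X g \<and> g u = a"
      if "u \<in> base H" "a \<in> base X" "type_of I \<delta> m X a = h u" for u a
      by (rule less.hyps[OF less_card sH' fH' _ hH']) (use that H(3) H'(1) in auto)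
    then obtain g where "is_hom I H X g" "\<And>v. v \<in> set t \<Longrightarrow> type_of I \<delta> m X (g v) = h v"
      using forest_lift_tuple[OF H(1,2) h t H' _ X] by blast
    then show ?thesis by blast
  qed
  show ?case
  proof (cases "\<exists>i\<in>I. \<exists>t\<in>rel H i. u \<in> set t")
    case True
    then obtain g where g: "is_hom I H X g" "type_of I \<delta> m X (g u) = type_of I \<delta> m X a"
      using lift u(3) by metis
    have "(H, u) \<in> type_of I \<delta> m X (g u)"
      using g(1) H u(1) by (auto simp: type_of_def pointed_structures_def)
    then show ?thesis unfolding g(2) by (auto simp: type_of_def)
  next
    case no_tuple: False
    have "\<exists>g. is_hom I H X g"
    proof (cases "\<exists>i\<in>I. rel H i \<noteq> {}")
      case True
      then show ?thesis using lift by blast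
    next
      case False
      then have "is_hom I H X (\<lambda>_. a)" using u(2) by (auto simp: is_hom_def)
      then show ?thesis by blast
    qed
    then obtain g where g: "is_hom I H X g" by blast
    have "is_hom I H X (g(u := a))"
      unfolding is_hom_def
    proof (intro conjI ballI subsetI)
      fix y assume "y \<in> (g(u := a)) ` base H"
      then show "y \<in> base X" using g u(2) by (auto simp: is_hom_def split: if_splits)
    next
      fix i y assume i: "i \<in> I" and "y \<in> map (g(u := a)) ` rel H i"
      then obtain t where t: "t \<in> rel H i" "y = map (g(u := a)) t" by blast
      then have "y = map g t" using no_tuple i by auto
      then show "y \<in> rel X i" using is_hom_tuple[OF g i t(1)] by simp
    qed
    then show ?thesis by (intro exI[of _ "g(u := a)"]) simp
  qed
qed

text \<open>
  Identifying the elements of equal type bounds the size in terms of \<open>m\<close> alone, and no new forest of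
  size at most \<open>m\<close> maps to the quotient.
\<close>

lemma type_quotient:
  fixes X :: "('i, nat) rel_structure"
  assumes type: "finite I" and X: "is_structure I \<delta> X"
    and fin: "finite (pointed_structures I \<delta> m)" and N: "2 ^ card (pointed_structures I \<delta> m) \<le> N"
  obtains D :: "('i, nat) rel_structure" where "is_structure I \<delta> D" "base D \<subseteq> {..<N}"
    "hom_to I X D" "\<And>B. factors_through_forest I \<delta> m B D \<Longrightarrow> factors_through_forest I \<delta> m B X"
proof -
  let ?tp = "type_of I \<delta> m X"
  let ?D = "image_structure ?tp X"
  have "base ?D \<subseteq> Pow (pointed_structures I \<delta> m)" by (auto simp: type_of_def)
  then have "card (base ?D) \<le> N"
    using card_mono[of "Pow (pointed_structures I \<delta> m)" "base ?D"] fin N by (simp add: card_Pow)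
  then obtain D :: "('i, nat) rel_structure" where D: "is_structure I \<delta> D" "base D \<subseteq> {..<N}"
    "hom_to I ?D D" "hom_to I D ?D"
    using relabel[OF is_structure_image[OF X]] by metis
  have "hom_to I X ?D" using is_hom_image unfolding hom_to_def by blast
  then have XD: "hom_to I X D" using D(3) by (rule hom_to_trans)
  have "factors_through_forest I \<delta> m B X" if B: "factors_through_forest I \<delta> m B D" for B
  proof -
    from B obtain H :: "('i, nat) rel_structure" where H: "is_structure I \<delta> H" "is_forest I H"
      "base H \<subseteq> {..<m}" "hom_to I B H" "hom_to I H D"
      by (auto simp: factors_through_forest_def)
    obtain h where h: "is_hom I H ?D h" using hom_to_trans[OF H(5) D(4)] by (auto simp: hom_to_def)
    obtain u where u: "u \<in> base H" using H(1) by (auto simp: is_structure_def)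
    then have "h u \<in> ?tp ` base X" using h by (auto simp: is_hom_def)
    then obtain a where "a \<in> base X" "?tp a = h u" by (metis imageE)
    then have "hom_to I H X"
      using forest_lift[OF type X H(1-3) h u] unfolding hom_to_def by blast
    with H show ?thesis by (auto simp: factors_through_forest_def)
  qed
  with D XD show thesis using that by blast
qed

lemma maximal_iff_bounded:
  fixes Q :: "('i, nat) rel_structure set"
  assumes type: "finite I" and Q: "\<And>B. B \<in> Q \<Longrightarrow> is_structure I \<delta> B \<and> card (base B) \<le> m"
    and fin: "finite (pointed_structures I \<delta> m)" and N: "2 ^ card (pointed_structures I \<delta> m) \<le> N"
  shows "(\<forall>A :: ('i, nat) rel_structure. is_structure I \<delta> A \<longrightarrow>
        (\<exists>B\<in>Q. hom_to I A B \<or> hom_to I B A)) \<longleftrightarrow>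
    (\<forall>A :: ('i, nat) rel_structure. is_structure I \<delta> A \<longrightarrow> base A \<subseteq> {..<N} \<longrightarrow>
        (\<exists>B\<in>Q. hom_to I A B \<or> factors_through_forest I \<delta> m B A))" (is "_ \<longleftrightarrow> ?R")
proof (rule trans[OF maximal_iff_forests[OF type Q]])
  show "(\<forall>A :: ('i, nat) rel_structure. is_structure I \<delta> A \<longrightarrow>
      (\<exists>B\<in>Q. hom_to I A B \<or> factors_through_forest I \<delta> m B A)) \<longleftrightarrow> ?R"
  proof (intro iffI allI impI)
    fix A :: "('i, nat) rel_structure"
    assume R: "\<forall>A :: ('i, nat) rel_structure. is_structure I \<delta> A \<longrightarrow> base A \<subseteq> {..<N} \<longrightarrow>
        (\<exists>B\<in>Q. hom_to I A B \<or> factors_through_forest I \<delta> m B A)" and A: "is_structure I \<delta> A"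
    obtain D :: "('i, nat) rel_structure" where D: "is_structure I \<delta> D" "base D \<subseteq> {..<N}"
      "hom_to I A D" "\<And>B. factors_through_forest I \<delta> m B D \<Longrightarrow> factors_through_forest I \<delta> m B A"
      using type_quotient[OF type A fin N] by metis
    then obtain B where "B \<in> Q" "hom_to I D B \<or> factors_through_forest I \<delta> m B D" using R by blast
    then show "\<exists>B\<in>Q. hom_to I A B \<or> factors_through_forest I \<delta> m B A"
      using D(3,4) by (blast intro: hom_to_trans)
  qed blast
qed assumption


section \<open>Recursive functions and decidable relations\<close>

text \<open>
  The arguments of a function are given by an environment; only the first \<open>k\<close> of its values count.
  A bound variable takes position \<open>0\<close> of the environment and shifts the others by one.
\<close>

definition recursive :: "nat \<Rightarrow> ((nat \<Rightarrow> nat) \<Rightarrow> nat) \<Rightarrow> bool" where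
  "recursive k f \<longleftrightarrow> (\<exists>r. \<forall>e. rec_eval r (map e [0..<k]) (f e))"

definition decidable_in :: "nat \<Rightarrow> ((nat \<Rightarrow> nat) \<Rightarrow> bool) \<Rightarrow> bool" where
  "decidable_in k P \<longleftrightarrow> recursive k (\<lambda>e. if P e then 1 else 0)"

lemma decidable_if_decidable_in:
  assumes "decidable_in 1 (\<lambda>e. e 0 \<in> L)"
  shows "decidable L"
proof -
  from assms obtain r where r: "rec_eval r (map e [0..<1]) (if e 0 \<in> L then 1 else 0)"
    for e :: "nat \<Rightarrow> nat"
    unfolding decidable_in_def recursive_def by blast
  have "rec_eval r [n] (if n \<in> L then 1 else 0)" for n
    using r[of "\<lambda>_. n"] by simp
  then show ?thesis unfolding decidable_def by blast
qed

lemma recursive_proj: "i < k \<Longrightarrow> recursive k (\<lambda>e. e i)"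
  unfolding recursive_def
  by (rule exI[of _ "Proj i"]) (use rec_eval.Proj[of i "map _ [0..<k]"] in auto)

lemma recursive_comp:
  assumes "recursive m g" and "\<And>j. j < m \<Longrightarrow> recursive k (F j)"
  shows "recursive k (\<lambda>e. g (\<lambda>j. F j e))"
proof -
  obtain rg where rg: "\<And>e. rec_eval rg (map e [0..<m]) (g e)"
    using assms(1) unfolding recursive_def by blast
  obtain R where R: "\<And>j e. j < m \<Longrightarrow> rec_eval (R j) (map e [0..<k]) (F j e)"
    using assms(2) unfolding recursive_def by metis
  have "rec_eval (Comp rg (map R [0..<m])) (map e [0..<k]) (g (\<lambda>j. F j e))" for e
  proof (rule rec_eval.Comp)
    show "list_all2 (\<lambda>r y. rec_eval r (map e [0..<k]) y) (map R [0..<m]) (map (\<lambda>j. F j e) [0..<m])"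
      using R by (simp add: list_all2_conv_all_nth)
    show "rec_eval rg (map (\<lambda>j. F j e) [0..<m]) (g (\<lambda>j. F j e))" using rg .
  qed
  then show ?thesis unfolding recursive_def by blast
qed

lemma recursive_0: "recursive k (\<lambda>_. 0)"
  unfolding recursive_def by (intro exI[of _ Zero] allI rec_eval.Zero)

lemma recursive_Suc:
  assumes "recursive k f"
  shows "recursive k (\<lambda>e. Suc (f e))"
proof -
  have "recursive 1 (\<lambda>e. Suc (e 0))"
    unfolding recursive_def by (intro exI[of _ Succ]) (simp add: rec_eval.Succ)
  from recursive_comp[OF this, of k "\<lambda>_. f"] show ?thesis using assms by simp
qed

lemma recursive_const: "recursive k (\<lambda>_. c)"
  by (induction c) (auto intro: recursive_0 recursive_Suc)

lemma recursive_rec_nat: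
  assumes a: "recursive k a" and b: "recursive k b"
    and g: "recursive (Suc (Suc k)) (\<lambda>e. g (e 0) (e (Suc 0)) (\<lambda>i. e (Suc (Suc i))))"
  shows "recursive k (\<lambda>e. rec_nat (a e) (\<lambda>n y. g n y e) (b e))"
proof -
  obtain ra where ra: "\<And>e. rec_eval ra (map e [0..<k]) (a e)"
    using a unfolding recursive_def by blast
  obtain rg where rg: "\<And>e. rec_eval rg (map e [0..<Suc (Suc k)])
      (g (e 0) (e (Suc 0)) (\<lambda>i. e (Suc (Suc i))))"
    using g unfolding recursive_def by blast
  have "rec_eval (Prec ra rg) (n # map e [0..<k]) (rec_nat (a e) (\<lambda>n y. g n y e) n)" for n e
  proof (induction n)
    case 0
    show ?case using ra by (simp add: rec_eval.Prec_0)
  next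
    case (Suc n)
    let ?y = "rec_nat (a e) (\<lambda>n y. g n y e) n"
    have "rec_eval rg (n # ?y # map e [0..<k]) (g n ?y e)"
      using rg[of "case_nat n (case_nat ?y e)"] by (simp add: map_upt_Suc del: upt_Suc)
    then show ?case using rec_eval.Prec_Suc[OF Suc.IH] by simp
  qed
  then have "\<exists>r. \<forall>e. rec_eval r (map e [0..<Suc k])
      (rec_nat (a (\<lambda>i. e (Suc i))) (\<lambda>n y. g n y (\<lambda>i. e (Suc i))) (e 0))"
    by (intro exI[of _ "Prec ra rg"]) (simp add: map_upt_Suc del: upt_Suc)
  then have rec: "recursive (Suc k)
      (\<lambda>e. rec_nat (a (\<lambda>i. e (Suc i))) (\<lambda>n y. g n y (\<lambda>i. e (Suc i))) (e 0))"
    unfolding recursive_def .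
  have "recursive k (case_nat b (\<lambda>i e. e i) j)" if "j < Suc k" for j
    using that b by (cases j) (simp_all add: recursive_proj)
  from recursive_comp[OF rec, of k "case_nat b (\<lambda>i e. e i)", OF this] show ?thesis by simp
qed

lemma recursive_shift:
  assumes "recursive k f"
  shows "recursive (d + k) (\<lambda>e. f (\<lambda>i. e (d + i)))"
proof (rule recursive_comp[OF assms])
  fix j assume "j < k"
  then show "recursive (d + k) (\<lambda>e. e (d + j))" by (intro recursive_proj) simp
qed

lemma recursive_shift2: "recursive k f \<Longrightarrow> recursive (Suc (Suc k)) (\<lambda>e. f (\<lambda>i. e (Suc (Suc i))))"
  using recursive_shift[of k f 2] by simp

lemma recursive_2:
  assumes "recursive 2 (\<lambda>e. h (e 0) (e (Suc 0)))" "recursive k f" "recursive k g"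
  shows "recursive k (\<lambda>e. h (f e) (g e))"
proof -
  have "recursive k (case_nat f (\<lambda>_. g) j)" for j using assms(2,3) by (cases j) simp_all
  from recursive_comp[OF assms(1), of k "case_nat f (\<lambda>_. g)", OF this] show ?thesis by simp
qed

lemma recursive_if:
  assumes "decidable_in k P" "recursive k f" "recursive k g"
  shows "recursive k (\<lambda>e. if P e then f e else g e)"
proof -
  have "recursive k (\<lambda>e. rec_nat (g e) (\<lambda>_ _. f e) (if P e then 1 else 0))"
    by (rule recursive_rec_nat[OF assms(3) assms(1)[unfolded decidable_in_def]
        recursive_shift2[OF assms(2)]])
  moreover have "rec_nat (g e) (\<lambda>_ _. f e) (if P e then 1 else 0) = (if P e then f e else g e)" for e
    by simp
  ultimately show ?thesis by simp
qed

lemma decidable_in_const: "decidable_in k (\<lambda>_. b)"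
  unfolding decidable_in_def by (rule recursive_const)

lemma decidable_in_not:
  assumes "decidable_in k P"
  shows "decidable_in k (\<lambda>e. \<not> P e)"
proof -
  have "recursive k (\<lambda>e. if P e then 0 else 1)"
    by (intro recursive_if recursive_const assms)
  moreover have "(\<lambda>e. if P e then 0 else 1) = (\<lambda>e. if \<not> P e then 1 else (0::nat))" by auto
  ultimately show ?thesis by (simp only: decidable_in_def)
qed

lemma decidable_in_conj:
  assumes "decidable_in k P" "decidable_in k Q"
  shows "decidable_in k (\<lambda>e. P e \<and> Q e)"
proof -
  have "recursive k (\<lambda>e. if P e then if Q e then 1 else 0 else 0)"
    by (intro recursive_if recursive_const assms)
  moreover have "(\<lambda>e. if P e then if Q e then 1 else 0 else 0) = (\<lambda>e. if P e \<and> Q e then 1 else (0::nat))"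
    by auto
  ultimately show ?thesis by (simp add: decidable_in_def)
qed

lemma decidable_in_disj:
  assumes "decidable_in k P" "decidable_in k Q"
  shows "decidable_in k (\<lambda>e. P e \<or> Q e)"
  using decidable_in_not[OF decidable_in_conj[OF assms[THEN decidable_in_not]]] by simp

lemma decidable_in_imp:
  assumes "decidable_in k P" "decidable_in k Q"
  shows "decidable_in k (\<lambda>e. P e \<longrightarrow> Q e)"
  using decidable_in_disj[OF decidable_in_not[OF assms(1)] assms(2)] by (simp only: imp_conv_disj)

lemma recursive_diff:
  assumes "recursive k f" "recursive k g"
  shows "recursive k (\<lambda>e. f e - g e)"
proof (rule recursive_2[OF _ assms])
  have pred: "recursive m (\<lambda>e. rec_nat 0 (\<lambda>n _. n) (f e))" if "recursive m f" for m f
    by (rule recursive_rec_nat[OF recursive_0 that]) (simp add: recursive_proj)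
  have pred_eq: "rec_nat 0 (\<lambda>n _. n) m = m - 1" for m :: nat by (cases m) simp_all
  have "recursive 2 (\<lambda>e. rec_nat (e 0) (\<lambda>_ y. rec_nat 0 (\<lambda>n _. n) y) (e (Suc 0)))"
    by (rule recursive_rec_nat) (intro pred recursive_proj; simp)+
  moreover have "rec_nat a (\<lambda>_ y. rec_nat 0 (\<lambda>n _. n) y) b = a - b" for a b :: nat
    by (induction b) (simp_all add: pred_eq)
  ultimately show "recursive 2 (\<lambda>e. e 0 - e (Suc 0))" by simp
qed

lemma recursive_add:
  assumes "recursive k f" "recursive k g"
  shows "recursive k (\<lambda>e. f e + g e)"
proof (rule recursive_2[OF _ assms])
  have "recursive 2 (\<lambda>e. rec_nat (e 0) (\<lambda>_ y. Suc y) (e (Suc 0)))"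
    by (rule recursive_rec_nat) (intro recursive_Suc recursive_proj; simp)+
  moreover have "rec_nat a (\<lambda>_ y. Suc y) b = a + b" for a b :: nat
    by (induction b) simp_all
  ultimately show "recursive 2 (\<lambda>e. e 0 + e (Suc 0))" by simp
qed

lemma recursive_mult:
  assumes "recursive k f" "recursive k g"
  shows "recursive k (\<lambda>e. f e * g e)"
proof (rule recursive_2[OF _ assms])
  have "recursive 2 (\<lambda>e. rec_nat 0 (\<lambda>_ y. y + e 0) (e (Suc 0)))"
    by (rule recursive_rec_nat) (intro recursive_0 recursive_add recursive_proj; simp)+
  moreover have "rec_nat 0 (\<lambda>_ y. y + a) b = a * b" for a b :: nat
    by (induction b) simp_all
  ultimately show "recursive 2 (\<lambda>e. e 0 * e (Suc 0))" by simp
qed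

lemma recursive_power:
  assumes "recursive k f" "recursive k g"
  shows "recursive k (\<lambda>e. f e ^ g e)"
proof (rule recursive_2[OF _ assms])
  have "recursive 2 (\<lambda>e. rec_nat 1 (\<lambda>_ y. y * e 0) (e (Suc 0)))"
    by (rule recursive_rec_nat) (intro recursive_const recursive_mult recursive_proj; simp)+
  moreover have "rec_nat 1 (\<lambda>_ y. y * a) b = a ^ b" for a b :: nat
    by (induction b) simp_all
  ultimately show "recursive 2 (\<lambda>e. e 0 ^ e (Suc 0))" by simp
qed

lemma decidable_in_eq_0:
  assumes "recursive k f"
  shows "decidable_in k (\<lambda>e. f e = 0)"
proof -
  have "recursive k (\<lambda>e. rec_nat 1 (\<lambda>_ _. 0) (f e))"
    by (rule recursive_rec_nat[OF recursive_const assms recursive_0])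
  moreover have "rec_nat 1 (\<lambda>_ _. 0) m = (if m = 0 then 1 else 0 :: nat)" for m by (cases m) simp_all
  ultimately show ?thesis by (simp add: decidable_in_def)
qed

lemma decidable_in_le:
  assumes "recursive k f" "recursive k g"
  shows "decidable_in k (\<lambda>e. f e \<le> g e)"
  using decidable_in_eq_0[OF recursive_diff[OF assms]] by simp

lemma decidable_in_less:
  assumes "recursive k f" "recursive k g"
  shows "decidable_in k (\<lambda>e. f e < g e)"
  using decidable_in_le[OF recursive_Suc[OF assms(1)] assms(2)] by (simp add: Suc_le_eq)

lemma decidable_in_eq:
  assumes "recursive k f" "recursive k g"
  shows "decidable_in k (\<lambda>e. f e = g e)"
  using decidable_in_conj[OF decidable_in_le[OF assms] decidable_in_le[OF assms(2,1)]]
  by (simp add: eq_iff)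

lemma recursive_mod:
  assumes "recursive k f" "recursive k g"
  shows "recursive k (\<lambda>e. f e mod g e)"
proof (rule recursive_2[OF _ assms])
  have "recursive 2 (\<lambda>e. rec_nat 0 (\<lambda>_ y. if Suc y = e (Suc 0) then 0 else Suc y) (e 0))"
    by (rule recursive_rec_nat)
      (intro recursive_if recursive_const recursive_Suc decidable_in_eq recursive_proj; simp)+
  moreover have "rec_nat 0 (\<lambda>_ y. if Suc y = b then 0 else Suc y) a = a mod b" for a b :: nat
    by (induction a) (simp_all add: mod_Suc)
  ultimately show "recursive 2 (\<lambda>e. e 0 mod e (Suc 0))" by simp
qed

lemma recursive_div:
  assumes "recursive k f" "recursive k g"
  shows "recursive k (\<lambda>e. f e div g e)"
proof (rule recursive_2[OF _ assms])
  have "recursive 2 (\<lambda>e. rec_nat 0 (\<lambda>n y. if Suc n mod e (Suc 0) = 0 then Suc y else y) (e 0))"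
    by (rule recursive_rec_nat)
      (intro recursive_if recursive_const recursive_Suc recursive_mod decidable_in_eq
        recursive_proj; simp)+
  moreover have "rec_nat 0 (\<lambda>n y. if Suc n mod b = 0 then Suc y else y) a = a div b" for a b :: nat
    by (induction a) (simp_all add: div_Suc)
  ultimately show "recursive 2 (\<lambda>e. e 0 div e (Suc 0))" by simp
qed

lemma recursive_prod_encode:
  assumes "recursive k f" "recursive k g"
  shows "recursive k (\<lambda>e. prod_encode (f e, g e))"
proof -
  have "recursive k (\<lambda>e. (f e + g e) * Suc (f e + g e) div 2 + f e)"
    by (intro recursive_add recursive_mult recursive_div recursive_Suc recursive_const assms)
  then show ?thesis by (simp only: prod_encode_def triangle_def prod.case)
qed

lemma decidable_in_set_decode:
  assumes "recursive k f" "recursive k g"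
  shows "decidable_in k (\<lambda>e. f e \<in> set_decode (g e))"
proof -
  have "decidable_in k (\<lambda>e. g e div 2 ^ f e mod 2 = 1)"
    by (intro decidable_in_eq recursive_mod recursive_div recursive_power recursive_const assms)
  then show ?thesis by (simp only: set_decode_def mem_Collect_eq odd_iff_mod_2_eq_one)
qed

lemma decidable_in_all_less:
  assumes b: "recursive k b" and P: "decidable_in (Suc k) (\<lambda>e. P (e 0) (\<lambda>i. e (Suc i)))"
  shows "decidable_in k (\<lambda>e. \<forall>x<b e. P x e)"
proof -
  have "recursive (Suc (Suc k)) (\<lambda>e. if P (e 0) (\<lambda>i. e (Suc (Suc i))) then 1 else 0)"
  proof -
    have "recursive (Suc (Suc k)) (case_nat (\<lambda>e. e 0) (\<lambda>i e. e (Suc (Suc i))) j)" if "j < Suc k" for j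
      using that by (cases j) (simp_all add: recursive_proj)
    from recursive_comp[OF P[unfolded decidable_in_def], of _ "case_nat (\<lambda>e. e 0) (\<lambda>i e. e (Suc (Suc i)))", OF this]
    show ?thesis by simp
  qed
  then have "recursive (Suc (Suc k)) (\<lambda>e. if P (e 0) (\<lambda>i. e (Suc (Suc i))) then e (Suc 0) else 0)"
    by (intro recursive_if recursive_const recursive_proj) (simp_all add: decidable_in_def)
  from recursive_rec_nat[OF recursive_const b this]
  have "recursive k (\<lambda>e. rec_nat 1 (\<lambda>n y. if P n e then y else 0) (b e))" .
  moreover have "rec_nat 1 (\<lambda>n y. if P n e then y else 0) m = (if \<forall>x<m. P x e then 1 else 0 :: nat)"
    for e m by (induction m) (auto simp: less_Suc_eq)
  ultimately show ?thesis by (simp add: decidable_in_def)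
qed

lemma decidable_in_ex_less:
  assumes b: "recursive k b" and P: "decidable_in (Suc k) (\<lambda>e. P (e 0) (\<lambda>i. e (Suc i)))"
  shows "decidable_in k (\<lambda>e. \<exists>x<b e. P x e)"
  using decidable_in_not[OF decidable_in_all_less[OF b, of "\<lambda>x e. \<not> P x e", OF decidable_in_not[OF P]]]
  by simp

lemma decidable_in_Ball:
  assumes "finite J" and "\<And>i. i \<in> J \<Longrightarrow> decidable_in k (P i)"
  shows "decidable_in k (\<lambda>e. \<forall>i\<in>J. P i e)"
  using assms by (induction J rule: finite_induct) (simp_all add: decidable_in_const decidable_in_conj)

lemma decidable_in_Bex:
  assumes "finite J" and "\<And>i. i \<in> J \<Longrightarrow> decidable_in k (P i)"
  shows "decidable_in k (\<lambda>e. \<exists>i\<in>J. P i e)"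
  using assms by (induction J rule: finite_induct) (simp_all add: decidable_in_const decidable_in_disj)

lemma recursive_list_encode:
  assumes "\<And>j. j < d \<Longrightarrow> recursive k (F j)"
  shows "recursive k (\<lambda>e. list_encode (map (\<lambda>j. F j e) [0..<d]))"
  using assms
proof (induction d arbitrary: F)
  case (Suc d)
  then have "recursive k (\<lambda>e. list_encode (map (\<lambda>j. F (Suc j) e) [0..<d]))" by simp
  then have "recursive k (\<lambda>e. Suc (prod_encode (F 0 e, list_encode (map (\<lambda>j. F (Suc j) e) [0..<d]))))"
    using Suc.prems by (intro recursive_Suc recursive_prod_encode) simp_all
  then show ?case by (simp add: map_upt_Suc del: upt_Suc)
qed (simp add: recursive_const)

lemma decidable_in_all_lists:
  assumes b: "recursive k b" and P: "decidable_in (d + k) (\<lambda>e. P (map e [0..<d]) (\<lambda>i. e (d + i)))"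
  shows "decidable_in k (\<lambda>e. \<forall>t. length t = d \<longrightarrow> set t \<subseteq> {..<b e} \<longrightarrow> P t e)"
  using P
proof (induction d arbitrary: P)
  case 0
  then show ?case by simp
next
  case (Suc d)
  have "decidable_in (d + k)
      (\<lambda>e. \<forall>x<b (\<lambda>i. e (d + i)). P (x # map e [0..<d]) (\<lambda>i. e (d + i)))"
    using Suc.prems
    by (intro decidable_in_all_less[OF recursive_shift[OF b]]) (simp add: map_upt_Suc del: upt_Suc)
  from Suc.IH[of "\<lambda>t e. \<forall>x<b e. P (x # t) e", OF this]
  have "decidable_in k (\<lambda>e. \<forall>t. length t = d \<longrightarrow> set t \<subseteq> {..<b e} \<longrightarrow> (\<forall>x<b e. P (x # t) e))" .
  moreover have "(\<forall>t. length t = d \<longrightarrow> set t \<subseteq> {..<b e} \<longrightarrow> (\<forall>x<b e. P (x # t) e)) \<longleftrightarrow>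
      (\<forall>t. length t = Suc d \<longrightarrow> set t \<subseteq> {..<b e} \<longrightarrow> P t e)" for e
    by (auto simp: length_Suc_conv)
  ultimately show ?case by simp
qed

lemma decidable_in_ex_lists:
  assumes b: "recursive k b" and P: "decidable_in (d + k) (\<lambda>e. P (map e [0..<d]) (\<lambda>i. e (d + i)))"
  shows "decidable_in k (\<lambda>e. \<exists>t. length t = d \<and> set t \<subseteq> {..<b e} \<and> P t e)"
  using decidable_in_not[OF decidable_in_all_lists[OF b, of d "\<lambda>t e. \<not> P t e", OF decidable_in_not[OF P]]]
  by simp

lemma decidable_in_comp:
  assumes "decidable_in m P" and "\<And>j. j < m \<Longrightarrow> recursive k (F j)"
  shows "decidable_in k (\<lambda>e. P (\<lambda>j. F j e))"
  using recursive_comp[OF assms(1)[unfolded decidable_in_def] assms(2)] by (simp add: decidable_in_def)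

lemma decidable_in_2:
  assumes "decidable_in 2 (\<lambda>e. P (e 0) (e (Suc 0)))" "recursive k f" "recursive k g"
  shows "decidable_in k (\<lambda>e. P (f e) (g e))"
proof -
  have "recursive k (case_nat f (\<lambda>_. g) j)" for j using assms(2,3) by (cases j) simp_all
  from decidable_in_comp[OF assms(1), of k "case_nat f (\<lambda>_. g)", OF this] show ?thesis by simp
qed

lemma decidable_in_4:
  assumes "decidable_in 4 (\<lambda>e. P (e 0) (e (Suc 0)) (e (Suc (Suc 0))) (e (Suc (Suc (Suc 0)))))"
    "recursive k f" "recursive k g" "recursive k f'" "recursive k g'"
  shows "decidable_in k (\<lambda>e. P (f e) (g e) (f' e) (g' e))"
proof -
  have "recursive k (case_nat f (case_nat g (case_nat f' (\<lambda>_. g'))) j)" for j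
    using assms(2-5) by (auto split: nat.split)
  from decidable_in_comp[OF assms(1), of k "case_nat f (case_nat g (case_nat f' (\<lambda>_. g')))", OF this]
  show ?thesis by simp
qed

lemmas decidable_intros =
  recursive_proj recursive_const recursive_Suc recursive_add recursive_mult recursive_power
  recursive_mod recursive_div recursive_prod_encode recursive_list_encode
  decidable_in_const decidable_in_not decidable_in_conj decidable_in_disj decidable_in_imp
  decidable_in_eq decidable_in_less decidable_in_set_decode decidable_in_all_less
  decidable_in_ex_less decidable_in_Ball decidable_in_Bex decidable_in_all_lists
  decidable_in_ex_lists


section \<open>Structures as numbers\<close>

lemma set_decode_less: "x \<in> set_decode b \<Longrightarrow> x < b"
proof -
  assume "x \<in> set_decode b"
  then have "odd (b div 2 ^ x)" by (simp add: set_decode_def)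
  then have "b div 2 ^ x \<noteq> 0" by (metis even_zero)
  then have "2 ^ x \<le> b" by (metis div_less not_le)
  then show "x < b" using less_exp[of x] by linarith
qed

lemma set_decode_eq_empty_iff: "set_decode b = {} \<longleftrightarrow> b = 0"
  by (metis set_decode_inverse set_decode_zero)

lemma prod_encode_mono: "a \<le> a' \<Longrightarrow> b \<le> b' \<Longrightarrow> prod_encode (a, b) \<le> prod_encode (a', b')"
  unfolding prod_encode_def triangle_def prod.case
  by (intro add_mono div_le_mono mult_le_mono Suc_le_mono[THEN iffD2]) simp_all

text \<open>
  Maps from \<open>{..<K}\<close> to \<open>{..<M}\<close> are coded by numbers below \<open>M ^ K\<close>, with the values as digits in base \<open>M\<close>.
\<close>

definition digit :: "nat \<Rightarrow> nat \<Rightarrow> nat \<Rightarrow> nat" where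
  "digit M h x = h div M ^ x mod M"

lemma ex_digits:
  assumes "\<forall>x<K. f x < M"
  shows "\<exists>h<M ^ K. \<forall>x<K. digit M h x = f x"
  using assms
proof (induction K arbitrary: f)
  case (Suc K)
  then obtain h where h: "h < M ^ K" "\<forall>x<K. digit M h x = f (Suc x)"
    using Suc.IH[of "\<lambda>x. f (Suc x)"] by (metis Suc_mono)
  have f0: "f 0 < M" using Suc.prems by simp
  have div: "(f 0 + M * h) div M = h" using f0 by simp
  show ?case
  proof (intro exI[of _ "f 0 + M * h"] conjI allI impI)
    have "f 0 + M * h < M * Suc h" using f0 by simp
    also have "\<dots> \<le> M * M ^ K" using h(1) by (intro mult_le_mono) simp_all
    finally show "f 0 + M * h < M ^ Suc K" by simp
    fix x assume x: "x < Suc K"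
    show "digit M (f 0 + M * h) x = f x"
    proof (cases x)
      case 0
      then show ?thesis using f0 by (simp add: digit_def)
    next
      case (Suc y)
      have "digit M (f 0 + M * h) x = digit M h y"
        unfolding digit_def Suc power_Suc div_mult2_eq div ..
      then show ?thesis using h(2) x Suc by simp
    qed
  qed
qed simp

definition coded_tuple :: "'i set \<Rightarrow> nat \<Rightarrow> nat \<Rightarrow> 'i \<Rightarrow> nat list \<Rightarrow> bool" where
  "coded_tuple I b r i t \<longleftrightarrow>
     set t \<subseteq> set_decode b \<and> prod_encode (to_nat_on I i, list_encode t) \<in> set_decode r"

text \<open>
  Every pair of numbers is decoded, numbers that are not codes of tuples of the right length being
  ignored. So quantifiers over structures become quantifiers over pairs of numbers, with \<open>b \<noteq> 0\<close> as
  the only condition. A structure has many codes; \<open>valid_code\<close> below singles out the one that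
  \<open>encode_structure\<close> assigns to it.
\<close>

definition coded :: "'i set \<Rightarrow> ('i \<Rightarrow> nat) \<Rightarrow> nat \<Rightarrow> nat \<Rightarrow> ('i, nat) rel_structure" where
  "coded I \<delta> b r = \<lparr>base = set_decode b,
     rel = (\<lambda>i. if i \<in> I then {t. length t = \<delta> i \<and> coded_tuple I b r i t} else {})\<rparr>"

lemma base_coded [simp]: "base (coded I \<delta> b r) = set_decode b"
  by (simp add: coded_def)

lemma rel_coded: "i \<in> I \<Longrightarrow> t \<in> rel (coded I \<delta> b r) i \<longleftrightarrow> length t = \<delta> i \<and> coded_tuple I b r i t"
  by (simp add: coded_def)

lemma is_structure_coded: "b \<noteq> 0 \<Longrightarrow> is_structure I \<delta> (coded I \<delta> b r)"
  by (auto simp: is_structure_def coded_def coded_tuple_def set_decode_eq_empty_iff)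

lemma coded_tuple_bounded: "coded_tuple I b r i t \<Longrightarrow> set t \<subseteq> {..<b}"
  by (auto simp: coded_tuple_def intro: set_decode_less)

definition tuple_codes :: "'i set \<Rightarrow> ('i, nat) rel_structure \<Rightarrow> nat set" where
  "tuple_codes I A = {prod_encode (to_nat_on I i, list_encode t) | i t. i \<in> I \<and> t \<in> rel A i}"

lemma finite_tuple_codes:
  assumes "finite I" "is_structure I \<delta> A"
  shows "finite (tuple_codes I A)"
proof -
  have "finite (Sigma I (rel A))" using assms by (rule finite_tuples)
  moreover have "tuple_codes I A =
      (\<lambda>(i, t). prod_encode (to_nat_on I i, list_encode t)) ` Sigma I (rel A)"
    by (force simp: tuple_codes_def)
  ultimately show ?thesis by simp
qed

lemma tuple_code_inject:
  assumes "finite I" "i \<in> I" "j \<in> I"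
  shows "prod_encode (to_nat_on I i, list_encode t) = prod_encode (to_nat_on I j, list_encode s)
    \<longleftrightarrow> i = j \<and> t = s"
  using inj_on_eq_iff[OF inj_on_to_nat_on[OF countable_finite[OF assms(1)]] assms(2,3)]
  by (simp add: prod_encode_eq list_encode_eq)

lemma coded_encode:
  assumes I: "finite I" and A: "is_structure I \<delta> A"
  shows "coded I \<delta> (set_encode (base A)) (set_encode (tuple_codes I A)) = A"
proof -
  have fin: "finite (base A)" "finite (tuple_codes I A)"
    using A finite_tuple_codes[OF I A] by (simp_all add: is_structure_def)
  have mem: "prod_encode (to_nat_on I i, list_encode t) \<in> tuple_codes I A \<longleftrightarrow> t \<in> rel A i"
    if i: "i \<in> I" for i t
  proof
    assume "prod_encode (to_nat_on I i, list_encode t) \<in> tuple_codes I A"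
    then obtain j s where "j \<in> I" "s \<in> rel A j"
      "prod_encode (to_nat_on I i, list_encode t) = prod_encode (to_nat_on I j, list_encode s)"
      unfolding tuple_codes_def by blast
    then show "t \<in> rel A i" using tuple_code_inject[OF I i, of j t s] by simp
  next
    assume "t \<in> rel A i"
    then show "prod_encode (to_nat_on I i, list_encode t) \<in> tuple_codes I A"
      unfolding tuple_codes_def using i by blast
  qed
  have "rel (coded I \<delta> (set_encode (base A)) (set_encode (tuple_codes I A))) i = rel A i" for i
  proof (cases "i \<in> I")
    case True
    show ?thesis
    proof (rule set_eqI)
      fix t
      show "t \<in> rel (coded I \<delta> (set_encode (base A)) (set_encode (tuple_codes I A))) i \<longleftrightarrow> t \<in> rel A i"
        using structure_tuple[OF A True, of t] mem[OF True, of t] fin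
        by (auto simp: rel_coded[OF True] coded_tuple_def)
    qed
  next
    case False
    then show ?thesis using A by (simp add: coded_def is_structure_def)
  qed
  then have "rel (coded I \<delta> (set_encode (base A)) (set_encode (tuple_codes I A))) = rel A" by blast
  then show ?thesis using fin(1) by simp
qed

definition valid_code :: "'i set \<Rightarrow> ('i \<Rightarrow> nat) \<Rightarrow> nat \<Rightarrow> nat \<Rightarrow> bool" where
  "valid_code I \<delta> b r \<longleftrightarrow> b \<noteq> 0 \<and> (\<forall>x<r. x \<in> set_decode r \<longrightarrow>
     (\<exists>i\<in>I. \<exists>t. length t = \<delta> i \<and> set t \<subseteq> {..<b} \<and>
        (coded_tuple I b r i t \<and> x = prod_encode (to_nat_on I i, list_encode t))))"

lemma encode_coded:
  assumes "valid_code I \<delta> b r"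
  shows "encode_structure I (coded I \<delta> b r) = prod_encode (b, r)"
proof -
  have "tuple_codes I (coded I \<delta> b r) = set_decode r"
  proof
    show "tuple_codes I (coded I \<delta> b r) \<subseteq> set_decode r"
      by (auto simp: tuple_codes_def rel_coded coded_tuple_def)
    show "set_decode r \<subseteq> tuple_codes I (coded I \<delta> b r)"
    proof
      fix x assume "x \<in> set_decode r"
      moreover from this have "x < r" by (rule set_decode_less)
      ultimately obtain i t where "i \<in> I" "length t = \<delta> i" "coded_tuple I b r i t"
        "x = prod_encode (to_nat_on I i, list_encode t)"
        using assms unfolding valid_code_def by blast
      then show "x \<in> tuple_codes I (coded I \<delta> b r)"
        unfolding tuple_codes_def using rel_coded[of i I t \<delta> b r] by blast
    qed
  qed
  then show ?thesis by (simp add: encode_structure_def tuple_codes_def[symmetric])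
qed

lemma valid_code_encode:
  assumes I: "finite I" and A: "is_structure I \<delta> A"
  shows "valid_code I \<delta> (set_encode (base A)) (set_encode (tuple_codes I A))"
    (is "valid_code I \<delta> ?b ?r")
proof -
  have fin: "finite (base A)" "base A \<noteq> {}" using A by (auto simp: is_structure_def)
  then have "?b \<noteq> 0" by (metis set_decode_zero set_encode_inverse)
  moreover have "\<exists>i\<in>I. \<exists>t. length t = \<delta> i \<and> set t \<subseteq> {..<?b} \<and>
      (coded_tuple I ?b ?r i t \<and> x = prod_encode (to_nat_on I i, list_encode t))"
    if "x \<in> set_decode ?r" for x
  proof -
    from that obtain i t where t: "i \<in> I" "t \<in> rel A i"
      "x = prod_encode (to_nat_on I i, list_encode t)"
      using finite_tuple_codes[OF I A] by (auto simp: tuple_codes_def)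
    then have "t \<in> rel (coded I \<delta> ?b ?r) i" using coded_encode[OF I A] by simp
    then have ct: "length t = \<delta> i" "coded_tuple I ?b ?r i t"
      by (simp_all only: rel_coded[OF t(1)])
    with coded_tuple_bounded[OF ct(2)] t(1,3) show ?thesis by (intro bexI[of _ i] exI[of _ t] conjI)
  qed
  ultimately show ?thesis unfolding valid_code_def by blast
qed

lemma MAC_iff_coded:
  assumes I: "finite I"
  shows "n \<in> MAC I \<delta> \<longleftrightarrow> n \<noteq> 0 \<and>
    (\<forall>b r. prod_encode (b, r) \<in> set_decode n \<longrightarrow> valid_code I \<delta> b r) \<and>
    maximal_antichain I \<delta> {coded I \<delta> b r | b r. prod_encode (b, r) \<in> set_decode n}"
    (is "_ \<longleftrightarrow> _ \<and> ?V \<and> maximal_antichain I \<delta> ?Q")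
proof
  assume "n \<in> MAC I \<delta>"
  then obtain Q where n: "n = encode_input I Q" and Q: "is_MAC_input I \<delta> Q" "maximal_antichain I \<delta> Q"
    by (auto simp: MAC_def)
  have str: "is_structure I \<delta> A" if "A \<in> Q" for A using Q(1) that by (simp add: is_MAC_input_def)
  have fin: "finite Q" "Q \<noteq> {}" using Q(1) by (simp_all add: is_MAC_input_def)
  have dec: "set_decode n = encode_structure I ` Q" using fin by (simp add: n encode_input_def)
  have enc: "encode_structure I A = prod_encode (set_encode (base A), set_encode (tuple_codes I A))" for A
    by (simp add: encode_structure_def tuple_codes_def)
  have code: "\<exists>A\<in>Q. b = set_encode (base A) \<and> r = set_encode (tuple_codes I A)"
    if "prod_encode (b, r) \<in> set_decode n" for b r
  proof -
    from that obtain A where "A \<in> Q" "prod_encode (b, r) = encode_structure I A"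
      unfolding dec by blast
    then show ?thesis by (intro bexI[of _ A]) (simp_all add: enc prod_encode_eq)
  qed
  have "n \<noteq> 0" using dec fin by auto
  moreover have ?V
  proof (intro allI impI)
    fix b r assume "prod_encode (b, r) \<in> set_decode n"
    from code[OF this] obtain A where A: "A \<in> Q" "b = set_encode (base A)"
      "r = set_encode (tuple_codes I A)" by blast
    show "valid_code I \<delta> b r" unfolding A(2,3) by (rule valid_code_encode[OF I str[OF A(1)]])
  qed
  moreover have "?Q = Q"
  proof
    show "?Q \<subseteq> Q"
    proof
      fix B assume "B \<in> ?Q"
      then obtain b r where br: "B = coded I \<delta> b r" "prod_encode (b, r) \<in> set_decode n" by blast
      obtain A where A: "A \<in> Q" "b = set_encode (base A)" "r = set_encode (tuple_codes I A)"
        using code[OF br(2)] by blast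
      have "B = A" unfolding br(1) A(2,3) by (rule coded_encode[OF I str[OF A(1)]])
      then show "B \<in> Q" using A(1) by simp
    qed
    show "Q \<subseteq> ?Q"
    proof
      fix A assume A: "A \<in> Q"
      then have "prod_encode (set_encode (base A), set_encode (tuple_codes I A)) \<in> set_decode n"
        unfolding dec enc by blast
      moreover have "A = coded I \<delta> (set_encode (base A)) (set_encode (tuple_codes I A))"
        using coded_encode[OF I str[OF A]] by simp
      ultimately show "A \<in> ?Q" by blast
    qed
  qed
  ultimately show "n \<noteq> 0 \<and> ?V \<and> maximal_antichain I \<delta> ?Q" using Q(2) by simp
next
  assume n: "n \<noteq> 0 \<and> ?V \<and> maximal_antichain I \<delta> ?Q"
  have Q: "?Q = (\<lambda>x. case prod_decode x of (b, r) \<Rightarrow> coded I \<delta> b r) ` set_decode n" (is "_ = ?f ` _")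
  proof
    show "?Q \<subseteq> ?f ` set_decode n"
    proof
      fix A assume "A \<in> ?Q"
      then obtain b r where "A = coded I \<delta> b r" "prod_encode (b, r) \<in> set_decode n" by blast
      then show "A \<in> ?f ` set_decode n" by (intro image_eqI[of _ _ "prod_encode (b, r)"]) simp_all
    qed
    show "?f ` set_decode n \<subseteq> ?Q"
    proof
      fix A assume "A \<in> ?f ` set_decode n"
      then obtain x where x: "x \<in> set_decode n" "A = ?f x" by blast
      obtain b r where "x = prod_encode (b, r)" by (metis prod_decode_inverse surj_pair)
      then show "A \<in> ?Q" using x by auto
    qed
  qed
  have enc: "encode_structure I (?f x) = x" if x: "x \<in> set_decode n" for x
  proof -
    obtain b r where br: "x = prod_encode (b, r)" by (metis prod_decode_inverse surj_pair)
    then have "valid_code I \<delta> b r" using x n by blast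
    then show ?thesis using encode_coded br by simp
  qed
  have "encode_structure I ` ?Q = set_decode n"
    unfolding Q image_image by (simp add: enc)
  then have "n = encode_input I ?Q" by (simp add: encode_input_def)
  moreover have "is_MAC_input I \<delta> ?Q"
    unfolding is_MAC_input_def
  proof (intro conjI ballI)
    show "finite ?Q" "?Q \<noteq> {}" unfolding Q using n by (simp_all add: set_decode_eq_empty_iff)
    fix A assume "A \<in> ?Q"
    then show "is_structure I \<delta> A" using n by (auto simp: valid_code_def intro: is_structure_coded)
  qed
  ultimately show "n \<in> MAC I \<delta>" unfolding MAC_def using n by blast
qed


section \<open>Bounds for codes\<close>

fun list_code_bound :: "nat \<Rightarrow> nat \<Rightarrow> nat" where
  "list_code_bound m 0 = 0"
| "list_code_bound m (Suc d) = Suc (prod_encode (m, list_code_bound m d))"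

lemma list_encode_le_bound:
  "set t \<subseteq> {..<m} \<Longrightarrow> length t \<le> d \<Longrightarrow> list_encode t \<le> list_code_bound m d"
proof (induction d arbitrary: t)
  case (Suc d)
  then show ?case by (cases t) (auto intro!: prod_encode_mono)
qed simp

definition code_bound :: "'i set \<Rightarrow> ('i \<Rightarrow> nat) \<Rightarrow> nat \<Rightarrow> nat" where
  "code_bound I \<delta> m =
     2 ^ (m + Suc (prod_encode (sum (to_nat_on I) I, list_code_bound m (sum \<delta> I))))"

lemma set_encode_less: 
  assumes "S \<subseteq> {..<m}"
  shows "set_encode S < 2 ^ m"
proof -
  have fin: "finite S" using assms finite_subset by blast
  have "set_encode S \<le> set_encode {..<m}"
    by (rule subset_decode_imp_le) (use assms fin in simp)
  also have "\<dots> < 2 ^ m" by (induction m) (simp_all add: lessThan_Suc)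
  finally show ?thesis .
qed

lemma codes_less_bound:
  assumes I: "finite I" and A: "is_structure I \<delta> A" and m: "base A \<subseteq> {..<m}"
  shows "set_encode (base A) < code_bound I \<delta> m" "set_encode (tuple_codes I A) < code_bound I \<delta> m"
proof -
  let ?K = "Suc (prod_encode (sum (to_nat_on I) I, list_code_bound m (sum \<delta> I)))"
  have "tuple_codes I A \<subseteq> {..<?K}"
  proof
    fix x assume "x \<in> tuple_codes I A"
    then obtain i t where t: "i \<in> I" "t \<in> rel A i"
      "x = prod_encode (to_nat_on I i, list_encode t)"
      by (auto simp: tuple_codes_def)
    have "list_encode t \<le> list_code_bound m (sum \<delta> I)"
      using structure_tuple[OF A t(1,2)] m member_le_sum[OF t(1), of \<delta>] I
      by (intro list_encode_le_bound) auto
    moreover have "to_nat_on I i \<le> sum (to_nat_on I) I"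
      using member_le_sum[OF t(1), of "to_nat_on I"] I by simp
    ultimately show "x \<in> {..<?K}" using prod_encode_mono by (auto simp: t(3) less_Suc_eq_le)
  qed
  then have "set_encode (tuple_codes I A) < 2 ^ ?K" by (rule set_encode_less)
  also have "\<dots> \<le> code_bound I \<delta> m" unfolding code_bound_def by (rule power_increasing) simp_all
  finally show "set_encode (tuple_codes I A) < code_bound I \<delta> m" .
  have "set_encode (base A) < 2 ^ m" using m by (rule set_encode_less)
  also have "\<dots> \<le> code_bound I \<delta> m" unfolding code_bound_def by (rule power_increasing) simp_all
  finally show "set_encode (base A) < code_bound I \<delta> m" .
qed

lemma ex_bounded_code_iff:
  assumes I: "finite I"
  shows "(\<exists>A :: ('i, nat) rel_structure. is_structure I \<delta> A \<and> base A \<subseteq> {..<m} \<and> P A) \<longleftrightarrow>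
    (\<exists>b<code_bound I \<delta> m. \<exists>r<code_bound I \<delta> m. b \<noteq> 0 \<and> set_decode b \<subseteq> {..<m} \<and> P (coded I \<delta> b r))"
    (is "?L \<longleftrightarrow> ?R")
proof
  assume ?L
  then obtain A :: "('i, nat) rel_structure" where A: "is_structure I \<delta> A" "base A \<subseteq> {..<m}" "P A"
    by blast
  have "finite (base A)" using A(1) by (simp add: is_structure_def)
  moreover have "set_encode (base A) \<noteq> 0"
    using valid_code_encode[OF I A(1)] by (simp add: valid_code_def)
  ultimately have "set_encode (base A) \<noteq> 0 \<and> set_decode (set_encode (base A)) \<subseteq> {..<m} \<and>
      P (coded I \<delta> (set_encode (base A)) (set_encode (tuple_codes I A)))"
    using coded_encode[OF I A(1)] A(2,3) by simp
  then show ?R using codes_less_bound[OF I A(1,2)] by blast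
next
  assume ?R
  then obtain b r where "b \<noteq> 0" "set_decode b \<subseteq> {..<m}" "P (coded I \<delta> b r)" by blast
  then show ?L using is_structure_coded by (intro exI[of _ "coded I \<delta> b r"]) simp
qed

lemma pointed_structures_bound:
  fixes I :: "'i set"
  assumes I: "finite I"
  shows "finite (pointed_structures I \<delta> m)"
    "card (pointed_structures I \<delta> m) \<le> code_bound I \<delta> m * code_bound I \<delta> m * m"
proof -
  let ?C = "{..<code_bound I \<delta> m}"
  let ?f = "\<lambda>((b, r), u). (coded I \<delta> b r, u)"
  have sub: "pointed_structures I \<delta> m \<subseteq> ?f ` ((?C \<times> ?C) \<times> {..<m})"
  proof
    fix p assume "p \<in> pointed_structures I \<delta> m"
    then obtain A u where p: "p = (A, u)" and A: "is_structure I \<delta> A" "base A \<subseteq> {..<m}" "u \<in> base A"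
      by (auto simp: pointed_structures_def)
    show "p \<in> ?f ` ((?C \<times> ?C) \<times> {..<m})"
      using codes_less_bound[OF I A(1,2)] coded_encode[OF I A(1)] A(2,3)
      by (intro image_eqI[of _ _ "((set_encode (base A), set_encode (tuple_codes I A)), u)"])
        (auto simp: p)
  qed
  then show "finite (pointed_structures I \<delta> m)" by (rule finite_subset) simp
  have "card (pointed_structures I \<delta> m) \<le> card (?f ` ((?C \<times> ?C) \<times> {..<m}))"
    by (rule card_mono[OF _ sub]) simp
  also have "\<dots> \<le> card ((?C \<times> ?C) \<times> {..<m})" by (rule card_image_le) simp
  finally show "card (pointed_structures I \<delta> m) \<le> code_bound I \<delta> m * code_bound I \<delta> m * m"
    by (simp add: card_cartesian_product)
qed


section \<open>Arithmetical descriptions\<close>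

definition hom_code :: "'i set \<Rightarrow> ('i \<Rightarrow> nat) \<Rightarrow> nat \<Rightarrow> nat \<Rightarrow> nat \<Rightarrow> nat \<Rightarrow> bool" where
  "hom_code I \<delta> b r b' r' \<longleftrightarrow> (\<exists>h<b' ^ b.
     (\<forall>x<b. x \<in> set_decode b \<longrightarrow> digit b' h x \<in> set_decode b') \<and>
     (\<forall>i\<in>I. \<forall>t. length t = \<delta> i \<longrightarrow> set t \<subseteq> {..<b} \<longrightarrow> coded_tuple I b r i t \<longrightarrow>
        prod_encode (to_nat_on I i, list_encode (map (digit b' h) t)) \<in> set_decode r'))"

lemma hom_code_iff:
  assumes "b' \<noteq> 0"
  shows "hom_code I \<delta> b r b' r' \<longleftrightarrow> hom_to I (coded I \<delta> b r) (coded I \<delta> b' r')"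
proof
  assume "hom_code I \<delta> b r b' r'"
  then obtain h where base: "\<And>x. x < b \<Longrightarrow> x \<in> set_decode b \<Longrightarrow> digit b' h x \<in> set_decode b'"
    and tuple: "\<And>i t. i \<in> I \<Longrightarrow> length t = \<delta> i \<Longrightarrow> set t \<subseteq> {..<b} \<Longrightarrow> coded_tuple I b r i t \<Longrightarrow>
      prod_encode (to_nat_on I i, list_encode (map (digit b' h) t)) \<in> set_decode r'"
    unfolding hom_code_def by blast
  have base': "digit b' h x \<in> set_decode b'" if "x \<in> set_decode b" for x
    using base[OF set_decode_less[OF that] that] .
  have "map (digit b' h) t \<in> rel (coded I \<delta> b' r') i" if i: "i \<in> I" and "t \<in> rel (coded I \<delta> b r) i" for i t
  proof -
    from that(2) have t: "length t = \<delta> i" "coded_tuple I b r i t" by (simp_all only: rel_coded[OF i])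
    moreover have "set (map (digit b' h) t) \<subseteq> set_decode b'"
      using t(2) base' by (auto simp: coded_tuple_def)
    ultimately show ?thesis
      using tuple[OF i t(1) coded_tuple_bounded[OF t(2)] t(2)] by (simp add: rel_coded[OF i] coded_tuple_def)
  qed
  then have "is_hom I (coded I \<delta> b r) (coded I \<delta> b' r') (digit b' h)"
    unfolding is_hom_def using base' by auto
  then show "hom_to I (coded I \<delta> b r) (coded I \<delta> b' r')" by (auto simp: hom_to_def)
next
  assume "hom_to I (coded I \<delta> b r) (coded I \<delta> b' r')"
  then obtain g where g: "is_hom I (coded I \<delta> b r) (coded I \<delta> b' r') g" by (auto simp: hom_to_def)
  have g_base: "g x \<in> set_decode b'" if "x \<in> set_decode b" for x
    using g that by (auto simp: is_hom_def)
  have "\<forall>x<b. (if x \<in> set_decode b then g x else 0) < b'"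
    using g_base set_decode_less assms by auto
  from ex_digits[OF this] obtain h where h: "h < b' ^ b" "\<forall>x<b. digit b' h x = (if x \<in> set_decode b then g x else 0)"
    by blast
  have hg: "digit b' h x = g x" if "x \<in> set_decode b" for x
    using h(2) that set_decode_less[OF that] by simp
  show "hom_code I \<delta> b r b' r'"
    unfolding hom_code_def
  proof (intro exI[of _ h] conjI allI impI ballI)
    fix i t assume i: "i \<in> I" and t: "length t = \<delta> i" "coded_tuple I b r i t"
    have eq: "map (digit b' h) t = map g t" using t(2) hg by (auto simp: coded_tuple_def)
    have "map g t \<in> rel (coded I \<delta> b' r') i"
      using t by (intro is_hom_tuple[OF g i]) (simp only: rel_coded[OF i])
    then show "prod_encode (to_nat_on I i, list_encode (map (digit b' h) t)) \<in> set_decode r'"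
      unfolding eq by (simp add: rel_coded[OF i] coded_tuple_def)
  qed (use h g_base hg in auto)
qed

definition forest_code :: "'i set \<Rightarrow> ('i \<Rightarrow> nat) \<Rightarrow> nat \<Rightarrow> nat \<Rightarrow> bool" where
  "forest_code I \<delta> b r \<longleftrightarrow> (\<forall>i\<in>I. \<forall>t. length t = \<delta> i \<longrightarrow> set t \<subseteq> {..<b} \<longrightarrow> coded_tuple I b r i t \<longrightarrow>
     (\<exists>h<b ^ b. (\<forall>k\<in>{..<\<delta> i}. \<forall>l\<in>{..<\<delta> i}. k \<noteq> l \<longrightarrow> digit b h (t ! k) \<noteq> digit b h (t ! l)) \<and>
       (\<forall>j\<in>I. \<forall>s. length s = \<delta> j \<longrightarrow> set s \<subseteq> {..<b} \<longrightarrow> coded_tuple I b r j s \<longrightarrow>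
          prod_encode (to_nat_on I j, list_encode s) \<noteq> prod_encode (to_nat_on I i, list_encode t) \<longrightarrow>
          (\<forall>k\<in>{..<\<delta> j}. \<forall>l\<in>{..<\<delta> j}. digit b h (s ! k) = digit b h (s ! l)))))"

lemma forest_code_iff:
  assumes I: "finite I" and b: "b \<noteq> 0"
  shows "forest_code I \<delta> b r \<longleftrightarrow> is_forest I (coded I \<delta> b r)"
proof
  assume F: "forest_code I \<delta> b r"
  show "is_forest I (coded I \<delta> b r)"
    unfolding is_forest_def
  proof (intro ballI)
    fix i t assume i: "i \<in> I" and "t \<in> rel (coded I \<delta> b r) i"
    then have t: "length t = \<delta> i" "coded_tuple I b r i t" by (simp_all only: rel_coded[OF i])
    from F[unfolded forest_code_def, rule_format, OF i t(1) coded_tuple_bounded[OF t(2)] t(2)]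
    obtain h where h: "\<And>k l. k < \<delta> i \<Longrightarrow> l < \<delta> i \<Longrightarrow> k \<noteq> l \<Longrightarrow> digit b h (t ! k) \<noteq> digit b h (t ! l)"
      "\<And>j s k l. j \<in> I \<Longrightarrow> length s = \<delta> j \<Longrightarrow> set s \<subseteq> {..<b} \<Longrightarrow> coded_tuple I b r j s \<Longrightarrow>
          prod_encode (to_nat_on I j, list_encode s) \<noteq> prod_encode (to_nat_on I i, list_encode t) \<Longrightarrow>
          k < \<delta> j \<Longrightarrow> l < \<delta> j \<Longrightarrow> digit b h (s ! k) = digit b h (s ! l)"
      unfolding Ball_def lessThan_iff by blast
    have "digit b h x = digit b h y"
      if j: "j \<in> I" "s \<in> rel (coded I \<delta> b r) j" "(j, s) \<noteq> (i, t)" "x \<in> set s" "y \<in> set s" for j s x y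
    proof -
      have s: "length s = \<delta> j" "coded_tuple I b r j s" using j(2) by (simp_all only: rel_coded[OF j(1)])
      have ne: "prod_encode (to_nat_on I j, list_encode s) \<noteq> prod_encode (to_nat_on I i, list_encode t)"
        using j(3) tuple_code_inject[OF I j(1) i, of s t] by blast
      obtain k l where "k < length s" "x = s ! k" "l < length s" "y = s ! l"
        using j(4,5) by (metis in_set_conv_nth)
      then show ?thesis
        using h(2)[OF j(1) s(1) coded_tuple_bounded[OF s(2)] s(2) ne, of k l] s(1) by simp
    qed
    moreover have "distinct (map (digit b h) t)"
      using h(1) t(1) by (simp add: distinct_conv_nth)
    ultimately show "\<exists>c :: nat \<Rightarrow> nat. distinct (map c t) \<and> (\<forall>j\<in>I. \<forall>s\<in>rel (coded I \<delta> b r) j.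
        (j, s) \<noteq> (i, t) \<longrightarrow> (\<forall>x\<in>set s. \<forall>y\<in>set s. c x = c y))"
      by (intro exI[of _ "digit b h"]) blast
  qed
next
  assume F: "is_forest I (coded I \<delta> b r)"
  show "forest_code I \<delta> b r"
    unfolding forest_code_def
  proof (intro ballI allI impI)
    fix i t assume i: "i \<in> I" and t: "length t = \<delta> i" "coded_tuple I b r i t"
    then have "t \<in> rel (coded I \<delta> b r) i" by (simp only: rel_coded[OF i])
    from bspec[OF bspec[OF F[unfolded is_forest_def] i] this]
    obtain c :: "nat \<Rightarrow> nat" where c: "distinct (map c t)"
      "\<forall>j\<in>I. \<forall>s\<in>rel (coded I \<delta> b r) j. (j, s) \<noteq> (i, t) \<longrightarrow> (\<forall>x\<in>set s. \<forall>y\<in>set s. c x = c y)"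
      by (elim exE conjE) (rule that)
    \<comment> \<open>Colours become smaller than \<open>b\<close> when every class is named by its least element.\<close>
    define f where "f x = (LEAST y. y \<in> set_decode b \<and> c y = c x)" for x
    have f: "f x \<in> set_decode b" "c (f x) = c x" if "x \<in> set_decode b" for x
      using LeastI[of "\<lambda>y. y \<in> set_decode b \<and> c y = c x" x] that unfolding f_def by blast+
    have f_eq: "f x = f y" if "c x = c y" for x y using that by (simp add: f_def)
    have "\<forall>x<b. (if x \<in> set_decode b then f x else 0) < b"
      using f(1) set_decode_less b by auto
    from ex_digits[OF this] obtain h where h: "h < b ^ b" "\<forall>x<b. digit b h x = (if x \<in> set_decode b then f x else 0)"
      by blast
    have hf: "digit b h x = f x" if "x \<in> set_decode b" for x
      using h(2) that set_decode_less[OF that] by simp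
    show "\<exists>h<b ^ b. (\<forall>k\<in>{..<\<delta> i}. \<forall>l\<in>{..<\<delta> i}. k \<noteq> l \<longrightarrow> digit b h (t ! k) \<noteq> digit b h (t ! l)) \<and>
       (\<forall>j\<in>I. \<forall>s. length s = \<delta> j \<longrightarrow> set s \<subseteq> {..<b} \<longrightarrow> coded_tuple I b r j s \<longrightarrow>
          prod_encode (to_nat_on I j, list_encode s) \<noteq> prod_encode (to_nat_on I i, list_encode t) \<longrightarrow>
          (\<forall>k\<in>{..<\<delta> j}. \<forall>l\<in>{..<\<delta> j}. digit b h (s ! k) = digit b h (s ! l)))"
    proof (intro exI[of _ h] conjI ballI allI impI)
      fix k l assume kl: "k \<in> {..<\<delta> i}" "l \<in> {..<\<delta> i}" "k \<noteq> l"
      have tb: "t ! k \<in> set_decode b" "t ! l \<in> set_decode b"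
        using t kl by (auto simp: coded_tuple_def)
      have "c (t ! k) \<noteq> c (t ! l)"
        using c(1) kl t(1) nth_eq_iff_index_eq[of "map c t" k l] by simp
      then show "digit b h (t ! k) \<noteq> digit b h (t ! l)"
        using f(2)[OF tb(1)] f(2)[OF tb(2)] hf[OF tb(1)] hf[OF tb(2)] by metis
    next
      fix j s k l
      assume j: "j \<in> I" and s: "length s = \<delta> j" "coded_tuple I b r j s" 
        and ne: "prod_encode (to_nat_on I j, list_encode s) \<noteq> prod_encode (to_nat_on I i, list_encode t)"
        and kl: "k \<in> {..<\<delta> j}" "l \<in> {..<\<delta> j}"
      have sb: "s ! k \<in> set_decode b" "s ! l \<in> set_decode b"
        using s kl by (auto simp: coded_tuple_def)
      have "s \<in> rel (coded I \<delta> b r) j" using s by (simp only: rel_coded[OF j])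
      moreover have "(j, s) \<noteq> (i, t)" using ne by blast
      moreover have "s ! k \<in> set s" "s ! l \<in> set s" using kl s(1) by simp_all
      ultimately have "c (s ! k) = c (s ! l)" using bspec[OF bspec[OF c(2) j], of s] by blast
      then show "digit b h (s ! k) = digit b h (s ! l)"
        using f_eq hf[OF sb(1)] hf[OF sb(2)] by metis
    qed (fact h(1))
  qed
qed


text \<open>
  All quantifiers are bounded by recursive functions of \<open>m\<close>: here \<open>N\<close> bounds the number of types with
  respect to pointed structures on subsets of \<open>{..<m}\<close>, hence the size of the quotients that have to
  be examined.
\<close>

lemma maximal_antichain_coded_iff:
  assumes I: "finite I" and V: "\<And>b r. prod_encode (b, r) \<in> S \<Longrightarrow> valid_code I \<delta> b r"
    and m: "S \<subseteq> {..<m}"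
  defines "N \<equiv> 2 ^ (code_bound I \<delta> m * code_bound I \<delta> m * m)"
  shows "maximal_antichain I \<delta> {coded I \<delta> b r | b r. prod_encode (b, r) \<in> S} \<longleftrightarrow>
    (\<forall>b<m. \<forall>r<m. \<forall>b'<m. \<forall>r'<m. prod_encode (b, r) \<in> S \<longrightarrow> prod_encode (b', r') \<in> S \<longrightarrow>
       prod_encode (b, r) \<noteq> prod_encode (b', r') \<longrightarrow> \<not> hom_code I \<delta> b r b' r') \<and>
    (\<forall>b<code_bound I \<delta> N. \<forall>r<code_bound I \<delta> N. b \<noteq> 0 \<longrightarrow> set_decode b \<subseteq> {..<N} \<longrightarrow>
       (\<exists>b'<m. \<exists>r'<m. prod_encode (b', r') \<in> S \<and> (hom_code I \<delta> b r b' r' \<or>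
          (\<exists>c<code_bound I \<delta> m. \<exists>s<code_bound I \<delta> m. c \<noteq> 0 \<and> set_decode c \<subseteq> {..<m} \<and>
             forest_code I \<delta> c s \<and> hom_code I \<delta> b' r' c s \<and> hom_code I \<delta> c s b r))))"
    (is "maximal_antichain I \<delta> ?Q \<longleftrightarrow> ?antichain \<and> ?maximal")
proof -
  have less: "b < m \<and> r < m" if "prod_encode (b, r) \<in> S" for b r
  proof -
    have "prod_encode (b, r) < m" using that m by blast
    then show ?thesis using le_prod_encode_1[of b r] le_prod_encode_2[of r b] by linarith
  qed
  have nz: "b \<noteq> 0" if "prod_encode (b, r) \<in> S" for b r
    using V[OF that] by (simp add: valid_code_def)
  have Q: "is_structure I \<delta> B \<and> card (base B) \<le> m" if "B \<in> ?Q" for B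
  proof -
    from that obtain b r where br: "B = coded I \<delta> b r" "prod_encode (b, r) \<in> S" by blast
    have "set_decode b \<subseteq> {..<m}" using less[OF br(2)] set_decode_less by fastforce
    then have "card (set_decode b) \<le> m" using card_mono[of "{..<m}"] by simp
    then show ?thesis using is_structure_coded[OF nz[OF br(2)]] br(1) by simp
  qed
  have inj: "coded I \<delta> b r = coded I \<delta> b' r' \<longleftrightarrow> prod_encode (b, r) = prod_encode (b', r')"
    if "prod_encode (b, r) \<in> S" "prod_encode (b', r') \<in> S" for b r b' r'
  proof
    assume eq: "coded I \<delta> b r = coded I \<delta> b' r'"
    show "prod_encode (b, r) = prod_encode (b', r')"
      using encode_coded[OF V[OF that(1)]] unfolding eq encode_coded[OF V[OF that(2)]] by (rule sym)
  qed (simp add: prod_encode_eq)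
  have hom: "hom_code I \<delta> b r b' r' \<longleftrightarrow> hom_to I (coded I \<delta> b r) (coded I \<delta> b' r')"
    if "prod_encode (b', r') \<in> S" for b r b' r'
    using hom_code_iff[OF nz[OF that]] .
  have all: "(\<forall>B\<in>?Q. P B) \<longleftrightarrow> (\<forall>b r. prod_encode (b, r) \<in> S \<longrightarrow> P (coded I \<delta> b r))" for P by blast
  have antichain: "(\<forall>A\<in>?Q. \<forall>B\<in>?Q. A \<noteq> B \<longrightarrow> \<not> hom_to I A B \<and> \<not> hom_to I B A) \<longleftrightarrow> ?antichain"
  proof
    assume L: "\<forall>A\<in>?Q. \<forall>B\<in>?Q. A \<noteq> B \<longrightarrow> \<not> hom_to I A B \<and> \<not> hom_to I B A"
    show ?antichain
    proof (intro allI impI)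
      fix b r b' r' assume S: "prod_encode (b, r) \<in> S" "prod_encode (b', r') \<in> S"
        "prod_encode (b, r) \<noteq> prod_encode (b', r')"
      then have "coded I \<delta> b r \<in> ?Q" "coded I \<delta> b' r' \<in> ?Q" by blast+
      moreover have "coded I \<delta> b r \<noteq> coded I \<delta> b' r'" using S inj by simp
      ultimately show "\<not> hom_code I \<delta> b r b' r'" unfolding hom[OF S(2)] using L by blast
    qed
  next
    assume R: ?antichain
    have "\<not> hom_to I (coded I \<delta> b r) (coded I \<delta> b' r')"
      if "prod_encode (b, r) \<in> S" "prod_encode (b', r') \<in> S" "coded I \<delta> b r \<noteq> coded I \<delta> b' r'"
      for b r b' r'
      using R less[OF that(1)] less[OF that(2)] that inj[OF that(1,2)] hom[OF that(2)] by metis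
    then show "\<forall>A\<in>?Q. \<forall>B\<in>?Q. A \<noteq> B \<longrightarrow> \<not> hom_to I A B \<and> \<not> hom_to I B A"
      unfolding all by metis
  qed
  have N: "2 ^ card (pointed_structures I \<delta> m) \<le> N"
    unfolding N_def using pointed_structures_bound(2)[OF I] by (intro power_increasing) simp_all
  have ftf: "factors_through_forest I \<delta> m B (coded I \<delta> b r) \<longleftrightarrow>
      (\<exists>c<code_bound I \<delta> m. \<exists>s<code_bound I \<delta> m. c \<noteq> 0 \<and> set_decode c \<subseteq> {..<m} \<and>
        is_forest I (coded I \<delta> c s) \<and> hom_to I B (coded I \<delta> c s) \<and>
        hom_to I (coded I \<delta> c s) (coded I \<delta> b r))" for B b r
    using ex_bounded_code_iff[OF I, of \<delta> m
      "\<lambda>H. is_forest I H \<and> hom_to I B H \<and> hom_to I H (coded I \<delta> b r)"]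
    unfolding factors_through_forest_def by (simp add: conj_ac)
  have point: "(\<exists>B\<in>?Q. hom_to I (coded I \<delta> b r) B \<or> factors_through_forest I \<delta> m B (coded I \<delta> b r)) \<longleftrightarrow>
      (\<exists>b'<m. \<exists>r'<m. prod_encode (b', r') \<in> S \<and> (hom_code I \<delta> b r b' r' \<or>
          (\<exists>c<code_bound I \<delta> m. \<exists>s<code_bound I \<delta> m. c \<noteq> 0 \<and> set_decode c \<subseteq> {..<m} \<and>
             forest_code I \<delta> c s \<and> hom_code I \<delta> b' r' c s \<and> hom_code I \<delta> c s b r)))"
    if b: "b \<noteq> 0" for b r
  proof -
    have "(\<exists>c<code_bound I \<delta> m. \<exists>s<code_bound I \<delta> m. c \<noteq> 0 \<and> set_decode c \<subseteq> {..<m} \<and>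
             forest_code I \<delta> c s \<and> hom_code I \<delta> b' r' c s \<and> hom_code I \<delta> c s b r) \<longleftrightarrow>
        factors_through_forest I \<delta> m (coded I \<delta> b' r') (coded I \<delta> b r)" for b' r'
      unfolding ftf by (simp add: forest_code_iff[OF I] hom_code_iff b cong: conj_cong)
    moreover have "(\<exists>B\<in>?Q. P B) \<longleftrightarrow> (\<exists>b'<m. \<exists>r'<m. prod_encode (b', r') \<in> S \<and> P (coded I \<delta> b' r'))" for P
      using less by blast
    ultimately show ?thesis using hom by (simp cong: conj_cong)
  qed
  let ?P = "\<lambda>A. \<exists>B\<in>?Q. hom_to I A B \<or> factors_through_forest I \<delta> m B A"
  have "(\<forall>A. is_structure I \<delta> A \<longrightarrow> base A \<subseteq> {..<N} \<longrightarrow> ?P A) \<longleftrightarrow>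
      \<not> (\<exists>A. is_structure I \<delta> A \<and> base A \<subseteq> {..<N} \<and> \<not> ?P A)" by blast
  also have "\<dots> \<longleftrightarrow> \<not> (\<exists>b<code_bound I \<delta> N. \<exists>r<code_bound I \<delta> N.
      b \<noteq> 0 \<and> set_decode b \<subseteq> {..<N} \<and> \<not> ?P (coded I \<delta> b r))"
    unfolding ex_bounded_code_iff[OF I, of \<delta> N "\<lambda>A. \<not> ?P A"] ..
  also have "\<dots> \<longleftrightarrow> (\<forall>b<code_bound I \<delta> N. \<forall>r<code_bound I \<delta> N.
      b \<noteq> 0 \<longrightarrow> set_decode b \<subseteq> {..<N} \<longrightarrow> ?P (coded I \<delta> b r))" by blast
  also have "\<dots> \<longleftrightarrow> ?maximal"
    by (intro iff_allI imp_cong refl point) assumption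
  finally have bounded: "(\<forall>A. is_structure I \<delta> A \<longrightarrow> base A \<subseteq> {..<N} \<longrightarrow> ?P A) \<longleftrightarrow> ?maximal" .
  have "(\<forall>A :: ('a, nat) rel_structure. is_structure I \<delta> A \<longrightarrow>
      (\<exists>B\<in>?Q. hom_to I A B \<or> hom_to I B A)) \<longleftrightarrow> ?maximal"
    by (rule trans[OF maximal_iff_bounded[OF I Q pointed_structures_bound(1)[OF I] N] bounded])
  then show ?thesis unfolding maximal_antichain_def antichain by (simp only:)
qed


section \<open>Deciding the arithmetical descriptions\<close>

lemma recursive_nth_map:
  "j < d \<Longrightarrow> recursive k (F j) \<Longrightarrow> recursive k (\<lambda>e. map (\<lambda>j. F j e) [0..<d] ! j)"
  by simp

lemma recursive_digit:
  assumes "recursive k f" "recursive k g" "recursive k h"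
  shows "recursive k (\<lambda>e. digit (f e) (g e) (h e))"
  unfolding digit_def by (intro decidable_intros assms)

lemma recursive_list_encode_digit:
  assumes "recursive k f" "recursive k g" "\<And>j. j < d \<Longrightarrow> recursive k (F j)"
  shows "recursive k (\<lambda>e. list_encode (map (digit (f e) (g e)) (map (\<lambda>j. F j e) [0..<d])))"
  unfolding map_map comp_def by (intro decidable_intros recursive_digit assms)

lemma decidable_in_coded_tuple:
  assumes "recursive k b" "recursive k r" "\<And>j. j < d \<Longrightarrow> recursive k (F j)"
  shows "decidable_in k (\<lambda>e. coded_tuple I (b e) (r e) i (map (\<lambda>j. F j e) [0..<d]))"
proof -
  have "decidable_in k (\<lambda>e. (\<forall>j\<in>{..<d}. F j e \<in> set_decode (b e)) \<and>
      prod_encode (to_nat_on I i, list_encode (map (\<lambda>j. F j e) [0..<d])) \<in> set_decode (r e))"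
    using assms by (intro decidable_intros) simp_all
  moreover have "(\<forall>j\<in>{..<d}. F j e \<in> set_decode (b e)) \<longleftrightarrow>
      set (map (\<lambda>j. F j e) [0..<d]) \<subseteq> set_decode (b e)" for e
    by auto
  ultimately show ?thesis by (simp only: coded_tuple_def)
qed

lemma decidable_in_base_bounded:
  assumes "recursive k b" "recursive k m"
  shows "decidable_in k (\<lambda>e. set_decode (b e) \<subseteq> {..<m e})"
proof (rule decidable_in_2[OF _ assms])
  have "decidable_in 2 (\<lambda>e. \<forall>x<e 0. x \<in> set_decode (e 0) \<longrightarrow> x < e (Suc 0))"
    by (intro decidable_intros) simp_all
  moreover have "(\<forall>x<b. x \<in> set_decode b \<longrightarrow> x < m) \<longleftrightarrow> set_decode b \<subseteq> {..<m}" for b m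
    using set_decode_less by blast
  ultimately show "decidable_in 2 (\<lambda>e. set_decode (e 0) \<subseteq> {..<e (Suc 0)})" by simp
qed

lemma decidable_in_valid_code:
  assumes "finite I" "recursive k b" "recursive k r"
  shows "decidable_in k (\<lambda>e. valid_code I \<delta> (b e) (r e))"
proof (rule decidable_in_2[OF _ assms(2,3)])
  show "decidable_in 2 (\<lambda>e. valid_code I \<delta> (e 0) (e (Suc 0)))"
    unfolding valid_code_def using assms(1)
    by (intro decidable_intros decidable_in_coded_tuple) simp_all
qed

lemma decidable_in_hom_code:
  assumes "finite I" "recursive k b" "recursive k r" "recursive k b'" "recursive k r'"
  shows "decidable_in k (\<lambda>e. hom_code I \<delta> (b e) (r e) (b' e) (r' e))"
proof (rule decidable_in_4[OF _ assms(2-5)])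
  show "decidable_in 4 (\<lambda>e. hom_code I \<delta> (e 0) (e (Suc 0)) (e (Suc (Suc 0))) (e (Suc (Suc (Suc 0)))))"
    unfolding hom_code_def using assms(1)
    by (intro recursive_list_encode_digit recursive_digit decidable_in_coded_tuple decidable_intros)
      simp_all
qed

lemma decidable_in_forest_code:
  assumes "finite I" "recursive k b" "recursive k r"
  shows "decidable_in k (\<lambda>e. forest_code I \<delta> (b e) (r e))"
proof (rule decidable_in_2[OF _ assms(2,3)])
  show "decidable_in 2 (\<lambda>e. forest_code I \<delta> (e 0) (e (Suc 0)))"
    unfolding forest_code_def using assms(1)
    by (intro recursive_nth_map recursive_digit decidable_in_coded_tuple decidable_intros) simp_all
qed

lemma recursive_code_bound:
  assumes "recursive k f"
  shows "recursive k (\<lambda>e. code_bound I \<delta> (f e))"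
proof -
  have "recursive k (\<lambda>e. list_code_bound (f e) d)" for d
    by (induction d) (auto intro!: decidable_intros assms)
  then show ?thesis unfolding code_bound_def by (intro decidable_intros assms)
qed


theorem mainTheorem9:
  fixes I :: "'i set" and \<delta> :: "'i \<Rightarrow> nat"
  assumes "is_type I \<delta>" and "card I \<le> 2"
  shows "decidable (MAC I \<delta>)"
proof (rule decidable_if_decidable_in)
  from assms(1) have I: "finite I" by (simp add: is_type_def)
  define C where "C = code_bound I \<delta>"
  define N :: "nat \<Rightarrow> nat" where "N n = 2 ^ (C n * C n * n)" for n
  define valid where "valid n \<longleftrightarrow> (\<forall>b<n. \<forall>r<n. prod_encode (b, r) \<in> set_decode n \<longrightarrow> valid_code I \<delta> b r)" for n
  define antichain where "antichain n \<longleftrightarrow>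
    (\<forall>b<n. \<forall>r<n. \<forall>b'<n. \<forall>r'<n. prod_encode (b, r) \<in> set_decode n \<longrightarrow>
       prod_encode (b', r') \<in> set_decode n \<longrightarrow> prod_encode (b, r) \<noteq> prod_encode (b', r') \<longrightarrow>
       \<not> hom_code I \<delta> b r b' r')" for n
  define maximal where "maximal n \<longleftrightarrow>
    (\<forall>b<C (N n). \<forall>r<C (N n). b \<noteq> 0 \<longrightarrow> set_decode b \<subseteq> {..<N n} \<longrightarrow>
       (\<exists>b'<n. \<exists>r'<n. prod_encode (b', r') \<in> set_decode n \<and> (hom_code I \<delta> b r b' r' \<or>
          (\<exists>c<C n. \<exists>s<C n. c \<noteq> 0 \<and> set_decode c \<subseteq> {..<n} \<and>
             forest_code I \<delta> c s \<and> hom_code I \<delta> b' r' c s \<and> hom_code I \<delta> c s b r))))" for n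
  \<comment> \<open>An input exceeds the codes of its structures and hence their elements, so it serves as size bound.\<close>
  have "n \<in> MAC I \<delta> \<longleftrightarrow> n \<noteq> 0 \<and> valid n \<and> antichain n \<and> maximal n" for n
  proof -
    have less: "b < n \<and> r < n" if "prod_encode (b, r) \<in> set_decode n" for b r
      using set_decode_less[OF that] le_prod_encode_1[of b r] le_prod_encode_2[of r b] by linarith
    then have valid: "valid n \<longleftrightarrow> (\<forall>b r. prod_encode (b, r) \<in> set_decode n \<longrightarrow> valid_code I \<delta> b r)"
      unfolding valid_def by blast
    have "maximal_antichain I \<delta> {coded I \<delta> b r | b r. prod_encode (b, r) \<in> set_decode n} \<longleftrightarrow>
        antichain n \<and> maximal n" if "valid n"
      unfolding antichain_def maximal_def N_def C_def
      by (rule maximal_antichain_coded_iff[OF I]) (use that valid set_decode_less in auto)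
    then show ?thesis unfolding MAC_iff_coded[OF I] valid[symmetric] by blast
  qed
  moreover have "decidable_in 1 (\<lambda>e. e 0 \<noteq> 0 \<and> valid (e 0) \<and> antichain (e 0) \<and> maximal (e 0))"
    unfolding valid_def antichain_def maximal_def N_def C_def using I
    by (intro decidable_intros decidable_in_base_bounded decidable_in_valid_code
        decidable_in_hom_code decidable_in_forest_code recursive_code_bound) simp_all
  ultimately show "decidable_in 1 (\<lambda>e. e 0 \<in> MAC I \<delta>)" by simp
qed

end
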